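(* Let $R\subseteq S$ be an extension of commutative rings where $S$ is a semilocal ring. Then $R\subseteq S$ is SL (that is, $\mathrm U(R)=\mathrm U(S)$) if and only if $R\subseteq S$ is a seminormal infra-integral FIP extension such that $R/M\cong\mathbb Z/2\mathbb Z$ for each $M\in\mathrm{MSupp}(S/R)$.
   Context: All rings are commutative, unital and nonzero. $\mathrm U(R)$ is the group of units of $R$. A ring is semilocal if it has finitely many maximal ideals. An extension $R\subseteq S$ is strongly local (SL) if $\mathrm U(R)=\mathrm U(S)$. It is seminormal if every $b\in S$ with $b^2\in R$ and $b^3\in R$ belongs to $R$. It is infra-integral if it is integral and, for each prime ideal $Q$ of $S$ with $P:=Q\cap R$, the residual field extension $R_P/PR_P\to S_Q/QS_Q$ is an isomorphism. It is an FIP extension if the set $[R,S]$ of all $R$-subalgebras of $S$ is finite. $\mathrm{MSupp}(S/R)$ is the set of maximal ideals $M$ of $R$ such that $(S/R)_M\neq 0$ ($S/R$ being viewed as an $R$-module). *)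

theory Defs
  imports "HOL-Algebra.IntRing" "HOL-Algebra.Polynomials"
begin

text \<open>
  A ring extension is given by an ambient ring \<open>S\<close> and a set \<open>R\<close> with \<open>subcring R S\<close>;
  the ring \<open>R\<close> itself is \<open>S\<lparr>carrier := R\<rparr>\<close>.
\<close>

section \<open>Localization\<close>

text \<open>
  In what follows \<open>T\<close> is meant to be a multiplicatively closed subset of \<open>R\<close> containing the unit.
  The pair \<open>(a, s)\<close> stands for the fraction \<open>a/s\<close>. The factor \<open>u\<close> is needed because \<open>R\<close> may have
  zero divisors.
\<close>

definition frac_rel :: "('a, 'b) ring_scheme \<Rightarrow> 'a set \<Rightarrow> (('a \<times> 'a) \<times> ('a \<times> 'a)) set" where
  "frac_rel R T = {((a, s), (b, t)). a \<in> carrier R \<and> b \<in> carrier R \<and> s \<in> T \<and> t \<in> T \<and>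
     (\<exists>u\<in>T. u \<otimes>\<^bsub>R\<^esub> (t \<otimes>\<^bsub>R\<^esub> a) = u \<otimes>\<^bsub>R\<^esub> (s \<otimes>\<^bsub>R\<^esub> b))}"

definition frac :: "('a, 'b) ring_scheme \<Rightarrow> 'a set \<Rightarrow> 'a \<Rightarrow> 'a \<Rightarrow> ('a \<times> 'a) set" where
  "frac R T a s = frac_rel R T `` {(a, s)}"

definition loc_ring :: "('a, 'b) ring_scheme \<Rightarrow> 'a set \<Rightarrow> ('a \<times> 'a) set ring" where
  "loc_ring R T =
    \<lparr>carrier = (carrier R \<times> T) // frac_rel R T,
     mult = (\<lambda>U V. \<Union>(a, s)\<in>U. \<Union>(b, t)\<in>V. frac R T (a \<otimes>\<^bsub>R\<^esub> b) (s \<otimes>\<^bsub>R\<^esub> t)),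
     one = frac R T \<one>\<^bsub>R\<^esub> \<one>\<^bsub>R\<^esub>,
     zero = frac R T \<zero>\<^bsub>R\<^esub> \<one>\<^bsub>R\<^esub>,
     add = (\<lambda>U V. \<Union>(a, s)\<in>U. \<Union>(b, t)\<in>V.
              frac R T ((t \<otimes>\<^bsub>R\<^esub> a) \<oplus>\<^bsub>R\<^esub> (s \<otimes>\<^bsub>R\<^esub> b)) (s \<otimes>\<^bsub>R\<^esub> t))\<rparr>"

definition mfrac_rel ::
  "'a set \<Rightarrow> ('a, 'm, 'c) module_scheme \<Rightarrow> (('m \<times> 'a) \<times> ('m \<times> 'a)) set" where
  "mfrac_rel T N = {((x, s), (y, t)). x \<in> carrier N \<and> y \<in> carrier N \<and> s \<in> T \<and> t \<in> T \<and>
     (\<exists>u\<in>T. u \<odot>\<^bsub>N\<^esub> (t \<odot>\<^bsub>N\<^esub> x) = u \<odot>\<^bsub>N\<^esub> (s \<odot>\<^bsub>N\<^esub> y))}"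

definition mfrac :: "'a set \<Rightarrow> ('a, 'm, 'c) module_scheme \<Rightarrow> 'm \<Rightarrow> 'a \<Rightarrow> ('m \<times> 'a) set" where
  "mfrac T N x s = mfrac_rel T N `` {(x, s)}"

text \<open>
  The localized module over \<open>loc_ring R T\<close>. A record of type \<open>module\<close> extends that of a ring; the
  fields \<open>mult\<close> and \<open>one\<close> play no role for a module and are left undefined.
\<close>

definition loc_module ::
  "('a, 'b) ring_scheme \<Rightarrow> 'a set \<Rightarrow> ('a, 'm, 'c) module_scheme \<Rightarrow>
     (('a \<times> 'a) set, ('m \<times> 'a) set) module" where
  "loc_module R T N =
    \<lparr>carrier = (carrier N \<times> T) // mfrac_rel T N,
     mult = undefined,
     one = undefined,
     zero = mfrac T N \<zero>\<^bsub>N\<^esub> \<one>\<^bsub>R\<^esub>,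
     add = (\<lambda>U V. \<Union>(x, s)\<in>U. \<Union>(y, t)\<in>V.
              mfrac T N ((t \<odot>\<^bsub>N\<^esub> x) \<oplus>\<^bsub>N\<^esub> (s \<odot>\<^bsub>N\<^esub> y)) (s \<otimes>\<^bsub>R\<^esub> t)),
     smult = (\<lambda>A U. \<Union>(a, s)\<in>A. \<Union>(x, t)\<in>U. mfrac T N (a \<odot>\<^bsub>N\<^esub> x) (s \<otimes>\<^bsub>R\<^esub> t))\<rparr>"

section \<open>Residue fields\<close>

abbreviation loc_at :: "('a, 'b) ring_scheme \<Rightarrow> 'a set \<Rightarrow> ('a \<times> 'a) set ring" where
  "loc_at R P \<equiv> loc_ring R (carrier R - P)"

text \<open>The extension \<open>P R\<^sub>P\<close> of \<open>P\<close> to \<open>R\<^sub>P\<close>.\<close>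

definition loc_ideal :: "('a, 'b) ring_scheme \<Rightarrow> 'a set \<Rightarrow> ('a \<times> 'a) set set" where
  "loc_ideal R P = genideal (loc_at R P) ((\<lambda>a. frac R (carrier R - P) a \<one>\<^bsub>R\<^esub>) ` P)"

definition residue_field :: "('a, 'b) ring_scheme \<Rightarrow> 'a set \<Rightarrow> ('a \<times> 'a) set set ring" where
  "residue_field R P = loc_at R P Quot loc_ideal R P"

text \<open>
  For a prime ideal \<open>Q\<close> of \<open>S\<close> and \<open>P = Q \<inter> R\<close>, the canonical maps \<open>R\<^sub>P \<rightarrow> S\<^sub>Q\<close>, sending \<open>a/s\<close> to \<open>a/s\<close>,
  and \<open>R\<^sub>P/PR\<^sub>P \<rightarrow> S\<^sub>Q/QS\<^sub>Q\<close>, sending the coset of \<open>y\<close> to the coset of the image of \<open>y\<close>. In both cases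
  the image of a class is the union of the images of its representatives, which all coincide.
\<close>

definition loc_map :: "('a, 'b) ring_scheme \<Rightarrow> 'a set \<Rightarrow> ('a \<times> 'a) set \<Rightarrow> ('a \<times> 'a) set" where
  "loc_map S Q U = (\<Union>(a, s)\<in>U. frac S (carrier S - Q) a s)"

definition residual_map ::
  "('a, 'b) ring_scheme \<Rightarrow> 'a set \<Rightarrow> ('a \<times> 'a) set set \<Rightarrow> ('a \<times> 'a) set set" where
  "residual_map S Q V = (\<Union>y\<in>V. loc_ideal S Q +>\<^bsub>loc_at S Q\<^esub> loc_map S Q y)"

section \<open>Ring extensions\<close>

definition semilocal :: "('a, 'b) ring_scheme \<Rightarrow> bool" where
  "semilocal S \<longleftrightarrow> finite {M. maximalideal M S}"

definition strongly_local :: "'a set \<Rightarrow> ('a, 'b) ring_scheme \<Rightarrow> bool" where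
  "strongly_local R S \<longleftrightarrow> Units (S\<lparr>carrier := R\<rparr>) = Units S"

definition seminormal :: "'a set \<Rightarrow> ('a, 'b) ring_scheme \<Rightarrow> bool" where
  "seminormal R S \<longleftrightarrow>
     (\<forall>b\<in>carrier S. b [^]\<^bsub>S\<^esub> (2::nat) \<in> R \<and> b [^]\<^bsub>S\<^esub> (3::nat) \<in> R \<longrightarrow> b \<in> R)"

definition integral_extension :: "'a set \<Rightarrow> ('a, 'b) ring_scheme \<Rightarrow> bool" where
  "integral_extension R S \<longleftrightarrow>
     (\<forall>x\<in>carrier S. \<exists>p\<in>carrier (univ_poly S R).
        p \<noteq> [] \<and> lead_coeff p = \<one>\<^bsub>S\<^esub> \<and> ring.eval S p x = \<zero>\<^bsub>S\<^esub>)"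

definition infra_integral :: "'a set \<Rightarrow> ('a, 'b) ring_scheme \<Rightarrow> bool" where
  "infra_integral R S \<longleftrightarrow> integral_extension R S \<and>
     (\<forall>Q. primeideal Q S \<longrightarrow>
        residual_map S Q \<in> ring_iso (residue_field (S\<lparr>carrier := R\<rparr>) (Q \<inter> R)) (residue_field S Q))"

text \<open>The \<open>R\<close>-subalgebras of \<open>S\<close> are the subrings of \<open>S\<close> that contain \<open>R\<close>.\<close>

definition intermediate_rings :: "'a set \<Rightarrow> ('a, 'b) ring_scheme \<Rightarrow> 'a set set" where
  "intermediate_rings R S = {T. subcring T S \<and> R \<subseteq> T}"

definition FIP :: "'a set \<Rightarrow> ('a, 'b) ring_scheme \<Rightarrow> bool" where
  "FIP R S \<longleftrightarrow> finite (intermediate_rings R S)"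

text \<open>
  The \<open>R\<close>-module \<open>S/R\<close>, whose elements are the additive cosets of \<open>R\<close> in \<open>S\<close>; \<open>r\<close> sends the coset
  of \<open>x\<close> to the coset of \<open>r x\<close>.
\<close>

definition quot_module :: "'a set \<Rightarrow> ('a, 'b) ring_scheme \<Rightarrow> ('a, 'a set) module" where
  "quot_module R S =
    \<lparr>carrier = a_rcosets\<^bsub>S\<^esub> R,
     mult = undefined,
     one = undefined,
     zero = R,
     add = set_add S,
     smult = (\<lambda>r U. \<Union>x\<in>U. R +>\<^bsub>S\<^esub> (r \<otimes>\<^bsub>S\<^esub> x))\<rparr>"

definition MSupp :: "'a set \<Rightarrow> ('a, 'b) ring_scheme \<Rightarrow> 'a set set" where
  "MSupp R S = {M. maximalideal M (S\<lparr>carrier := R\<rparr>) \<and>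
     (let N = loc_module (S\<lparr>carrier := R\<rparr>) (R - M) (quot_module R S) in carrier N \<noteq> {\<zero>\<^bsub>N\<^esub>})}"

end

(*
  Suppose U(R) = U(S), and let J be the Jacobson radical of S, so that 1 + J consists of units and
  J lies in R. Let M be a maximal ideal of S with more than two residue classes and s an element that
  is 1 modulo M and 0 modulo the other maximal ideals. Then 1 + s z is a unit unless z = -1 modulo M;
  every z is a sum of two elements that avoid this class, so s S lies in R. The sum e of these s
  satisfies e S <= R, and d = (1 - e) b satisfies d^2 - d in J for every b. All properties on the
  right-hand side follow from these two facts.

  Conversely, suppose that a unit is not in R. The elements of S whose residue is constant on the
  primes over each maximal ideal of R with residue field of order two form a ring that contains R
  and all units of S. By FIP it contains a ring B that is minimal among those properly containing R;
  choose b in B outside R, so that B = R[b]. Let P be a maximal ideal of R that contains all t with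
  t b in R; then P is in the support. Minimality gives R + P B = B or P B <= R. The first case
  contradicts the choice of P by Nakayama's lemma. In the second case b minus its constant residue
  lies in all primes of S over P, so one of its powers lies in P B, hence in R, and seminormality
  puts b itself in R.
*)
theory Submission
  imports Defs
begin

section \<open>Ideals of commutative rings\<close>

text \<open>Until the final theorem \<open>R\<close> names the big ring and \<open>K\<close> the
  small one. In the converse an arbitrary minimal ring above the small one would not do: the
  diagonal F_2 in F_2 x F_2 satisfies both sides of the equivalence, although it is a proper minimal
  extension. A contradiction arises only below the ring of constant residues. Of the three classical
  kinds of minimal integral extension, the inert one is excluded by the residue fields, the ramified
  one by seminormality and the decomposed one by the constancy of residues; a single nilpotence
  argument covers all three. The small ring need not be noetherian. The finite generation behind
  Nakayama's lemma comes from the integral equation of the single element b, hence the polynomials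
  of bounded degree in b. Residual isomorphisms and support are traded for statements about
  elements: t b - a in Q with t outside Q, and t s outside the small ring for t outside M. The
  algebra is then free of localizations.\<close>

context cring
begin

lemma minus_add_simps:
  assumes "p \<in> carrier R" "q \<in> carrier R" "r \<in> carrier R"
  shows "\<ominus> p \<oplus> q = q \<ominus> p" "p \<oplus> \<ominus> q = p \<ominus> q"
    "p \<oplus> (q \<ominus> r) = (p \<oplus> q) \<ominus> r" "(p \<ominus> q) \<oplus> r = (p \<oplus> r) \<ominus> q"
    "p \<ominus> (q \<ominus> r) = (p \<oplus> r) \<ominus> q" "(p \<ominus> q) \<ominus> r = p \<ominus> (q \<oplus> r)"
    "\<ominus> (p \<ominus> q) = q \<ominus> p" "p \<ominus> \<ominus> q = p \<oplus> q" "\<ominus> p \<ominus> q = \<ominus> (p \<oplus> q)"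
  using assms by (simp_all add: a_minus_def minus_add a_ac)

lemma minus_mult_simps:
  assumes "p \<in> carrier R" "q \<in> carrier R" "r \<in> carrier R"
  shows "\<ominus> p \<otimes> q = \<ominus> (p \<otimes> q)" "p \<otimes> \<ominus> q = \<ominus> (p \<otimes> q)"
    "p \<otimes> (q \<ominus> r) = p \<otimes> q \<ominus> p \<otimes> r" "(p \<ominus> q) \<otimes> r = p \<otimes> r \<ominus> q \<otimes> r"
  using assms by (simp_all add: a_minus_def l_minus r_minus l_distr r_distr)

lemma minus_eq_simps:
  assumes "p \<in> carrier R" "q \<in> carrier R" "r \<in> carrier R"
  shows "p \<ominus> q = r \<longleftrightarrow> p = r \<oplus> q" "r = p \<ominus> q \<longleftrightarrow> r \<oplus> q = p"
    "p \<ominus> q = \<ominus> r \<longleftrightarrow> p \<oplus> r = q" "\<ominus> r = p \<ominus> q \<longleftrightarrow> q = p \<oplus> r"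
proof -
  have 1: "x \<ominus> y = z \<longleftrightarrow> x = z \<oplus> y" if "x \<in> carrier R" "y \<in> carrier R" "z \<in> carrier R" for x y z
    using that by (metis a_minus_def add.inv_solve_right)
  show "p \<ominus> q = r \<longleftrightarrow> p = r \<oplus> q" "r = p \<ominus> q \<longleftrightarrow> r \<oplus> q = p"
    using 1[OF assms] by auto
  have "p \<ominus> q = \<ominus> r \<longleftrightarrow> p = q \<ominus> r"
    using 1[of p q "\<ominus> r"] assms by (simp add: minus_add_simps)
  also have "\<dots> \<longleftrightarrow> p \<oplus> r = q" using 1[of q r p] assms by auto
  finally show "p \<ominus> q = \<ominus> r \<longleftrightarrow> p \<oplus> r = q" .
  then show "\<ominus> r = p \<ominus> q \<longleftrightarrow> q = p \<oplus> r" by auto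
qed

text \<open>Rewriting with these rules moves every subtraction to the root of a term and from there to the
  other side of an equation; what remains is an identity of commutative semirings, which ordered
  rewriting decides.\<close>

lemmas ring_normal = minus_add_simps minus_mult_simps minus_eq_simps l_distr r_distr a_ac m_ac

lemma ideal_closed:
  assumes "ideal I R"
  shows "I \<subseteq> carrier R" and "\<zero> \<in> I"
    and "\<And>a b. a \<in> I \<Longrightarrow> b \<in> I \<Longrightarrow> a \<oplus> b \<in> I"
    and "\<And>a. a \<in> I \<Longrightarrow> \<ominus> a \<in> I"
    and "\<And>a b. a \<in> I \<Longrightarrow> b \<in> I \<Longrightarrow> a \<ominus> b \<in> I"
    and "\<And>a r. a \<in> I \<Longrightarrow> r \<in> carrier R \<Longrightarrow> r \<otimes> a \<in> I"
    and "\<And>a r. a \<in> I \<Longrightarrow> r \<in> carrier R \<Longrightarrow> a \<otimes> r \<in> I"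
proof -
  interpret ideal I R by fact
  show "I \<subseteq> carrier R" "\<zero> \<in> I"
    "\<And>a b. a \<in> I \<Longrightarrow> b \<in> I \<Longrightarrow> a \<oplus> b \<in> I" "\<And>a. a \<in> I \<Longrightarrow> \<ominus> a \<in> I"
    "\<And>a r. a \<in> I \<Longrightarrow> r \<in> carrier R \<Longrightarrow> r \<otimes> a \<in> I"
    "\<And>a r. a \<in> I \<Longrightarrow> r \<in> carrier R \<Longrightarrow> a \<otimes> r \<in> I"
    by (simp_all add: a_subset a_closed I_l_closed I_r_closed)
  then show "\<And>a b. a \<in> I \<Longrightarrow> b \<in> I \<Longrightarrow> a \<ominus> b \<in> I"
    by (simp add: a_minus_def)
qed

lemma cring_idealI:
  assumes "I \<subseteq> carrier R" and "\<zero> \<in> I"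
    and "\<And>a b. a \<in> I \<Longrightarrow> b \<in> I \<Longrightarrow> a \<oplus> b \<in> I"
    and "\<And>a r. a \<in> I \<Longrightarrow> r \<in> carrier R \<Longrightarrow> r \<otimes> a \<in> I"
  shows "ideal I R"
proof (rule idealI)
  show "ring R" by (rule ring_axioms)
  have neg: "\<ominus> a \<in> I" if "a \<in> I" for a
  proof -
    have "a \<in> carrier R" using that assms(1) by blast
    then have "\<ominus> \<one> \<otimes> a = \<ominus> a" by (simp add: l_minus)
    then show ?thesis using assms(4)[OF that, of "\<ominus> \<one>"] by simp
  qed
  show "subgroup I (add_monoid R)"
    by (rule add.subgroupI[OF assms(1) _ neg assms(3)]) (use assms(2) in auto)
  fix a x assume "a \<in> I" and x: "x \<in> carrier R"
  then have "a \<in> carrier R" and *: "x \<otimes> a \<in> I" using assms(1,4) by blast+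
  show "x \<otimes> a \<in> I" by fact
  show "a \<otimes> x \<in> I" using * m_comm[OF \<open>a \<in> carrier R\<close> x] by simp
qed

lemma ideal_adjoin:
  assumes "ideal I R" and "x \<in> carrier R"
  shows "ideal {q \<oplus> x \<otimes> r | q r. q \<in> I \<and> r \<in> carrier R} R" (is "ideal ?J R")
    and "I \<subseteq> {q \<oplus> x \<otimes> r | q r. q \<in> I \<and> r \<in> carrier R}"
    and "x \<in> {q \<oplus> x \<otimes> r | q r. q \<in> I \<and> r \<in> carrier R}"
proof -
  note I = ideal_closed[OF assms(1)]
  have x: "x \<in> carrier R" by fact
  have zero: "\<zero> \<oplus> x \<otimes> \<one> = x" "q \<in> I \<Longrightarrow> q \<oplus> x \<otimes> \<zero> = q" for q
    using x I(1) by auto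
  have mem: "q \<oplus> x \<otimes> r \<in> ?J" if "q \<in> I" "r \<in> carrier R" for q r using that by blast
  show "I \<subseteq> ?J"
  proof
    fix q assume "q \<in> I"
    then show "q \<in> ?J" using mem[of q \<zero>] zero(2)[of q] by simp
  qed
  show "x \<in> ?J" using mem[of \<zero> \<one>] zero(1) I(2) by simp
  show "ideal ?J R"
  proof (rule cring_idealI)
    show "?J \<subseteq> carrier R" using I(1) x by auto
    show "\<zero> \<in> ?J" using \<open>I \<subseteq> ?J\<close> I(2) by auto
    fix a b assume "a \<in> ?J" "b \<in> ?J"
    then obtain q r q' r' where *: "a = q \<oplus> x \<otimes> r" "b = q' \<oplus> x \<otimes> r'" "q \<in> I" "q' \<in> I"
      and r: "r \<in> carrier R" "r' \<in> carrier R" by auto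
    have q: "q \<in> carrier R" "q' \<in> carrier R" using * I(1) by auto
    have "a \<oplus> b = (q \<oplus> q') \<oplus> x \<otimes> (r \<oplus> r')"
      unfolding * using x q r by (simp add: ring_normal)
    then show "a \<oplus> b \<in> ?J" using * I(3) r by blast
  next
    fix a s assume "a \<in> ?J" and s: "s \<in> carrier R"
    then obtain q r where *: "a = q \<oplus> x \<otimes> r" "q \<in> I" and r: "r \<in> carrier R" by auto
    have q: "q \<in> carrier R" using * I(1) by auto
    have "s \<otimes> a = (s \<otimes> q) \<oplus> x \<otimes> (s \<otimes> r)"
      unfolding * using x q r s by (simp add: ring_normal)
    then show "s \<otimes> a \<in> ?J" using * I(6) r s by blast
  qed
qed

text \<open>Zorn's lemma is applied once, for an arbitrary set \<open>W\<close>: with W = {1} it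
  yields maximal ideals, with a multiplicative \<open>W\<close> prime ideals. Maximality is returned
  in the form that gets used: adjoining any further element makes the ideal meet
  \<open>W\<close>.\<close>

lemma ideal_avoiding:
  assumes "ideal I R" and "I \<inter> W = {}"
  obtains Q where "ideal Q R" "I \<subseteq> Q" "Q \<inter> W = {}"
    "\<And>x. x \<in> carrier R \<Longrightarrow> x \<notin> Q \<Longrightarrow> \<exists>q\<in>Q. \<exists>r\<in>carrier R. q \<oplus> x \<otimes> r \<in> W"
proof -
  define A where "A = {J. ideal J R \<and> I \<subseteq> J \<and> J \<inter> W = {}}"
  have "\<exists>M\<in>A. \<forall>Y\<in>A. M \<subseteq> Y \<longrightarrow> Y = M"
  proof (rule subset_Zorn_nonempty)
    show "A \<noteq> {}" using assms by (auto simp: A_def)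
    fix C assume C: "C \<noteq> {}" "subset.chain A C"
    then have id: "ideal J R" if "J \<in> C" for J
      using that by (auto simp: A_def subset.chain_def)
    note cl = ideal_closed[OF id]
    have "ideal (\<Union>C) R"
    proof (rule cring_idealI)
      show "\<Union>C \<subseteq> carrier R" using cl(1) by blast
      show "\<zero> \<in> \<Union>C" using cl(2) C(1) by blast
      show "r \<otimes> a \<in> \<Union>C" if "a \<in> \<Union>C" "r \<in> carrier R" for a r using that cl(6) by blast
      fix a b assume "a \<in> \<Union>C" "b \<in> \<Union>C"
      then obtain J J' where J: "J \<in> C" "J' \<in> C" "a \<in> J" "b \<in> J'" by auto
      then have "J \<subseteq> J' \<or> J' \<subseteq> J" using C(2) unfolding subset.chain_def by blast
      then have "a \<in> J \<and> b \<in> J \<or> a \<in> J' \<and> b \<in> J'" using J by blast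
      then show "a \<oplus> b \<in> \<Union>C" using cl(3) J by blast
    qed
    moreover have IC: "I \<subseteq> J" "J \<inter> W = {}" if "J \<in> C" for J
      using that C(2) by (auto simp: subset.chain_def A_def)
    obtain J where "J \<in> C" using C(1) by auto
    then have "I \<subseteq> \<Union>C" using IC(1) by blast
    moreover have "\<Union>C \<inter> W = {}" using IC(2) by blast
    ultimately show "\<Union>C \<in> A" by (simp add: A_def)
  qed
  then obtain Q where "Q \<in> A" and max: "\<And>Y. Y \<in> A \<Longrightarrow> Q \<subseteq> Y \<Longrightarrow> Y = Q"
    by auto
  then have Q: "ideal Q R" "I \<subseteq> Q" "Q \<inter> W = {}" by (simp_all add: A_def)
  have "\<exists>q\<in>Q. \<exists>r\<in>carrier R. q \<oplus> x \<otimes> r \<in> W" if x: "x \<in> carrier R" "x \<notin> Q" for x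
  proof (rule ccontr)
    assume neg: "\<not> ?thesis"
    let ?J = "{q \<oplus> x \<otimes> r | q r. q \<in> Q \<and> r \<in> carrier R}"
    have "?J \<inter> W = {}" using neg by auto
    then have "?J \<in> A"
      using ideal_adjoin(1,2)[OF Q(1) x(1)] Q(2) unfolding A_def by simp
    then have "?J = Q" using max ideal_adjoin(2)[OF Q(1) x(1)] by simp
    then show False using ideal_adjoin(3)[OF Q(1) x(1)] x(2) by simp
  qed
  then show thesis by (rule that[OF Q])
qed

text \<open>An ideal that is maximal among those disjoint from a multiplicative set is prime. The
  clause on meeting \<open>W\<close> stays in the conclusion because
  \<open>prime_over_avoiding\<close> argues with it beyond primality.\<close>

lemma prime_avoiding:
  assumes "ideal I R" and "I \<inter> W = {}" and "\<one> \<in> W" and "W \<subseteq> carrier R"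
    and mult: "\<And>x y. x \<in> W \<Longrightarrow> y \<in> W \<Longrightarrow> x \<otimes> y \<in> W"
  obtains Q where "primeideal Q R" "I \<subseteq> Q" "Q \<inter> W = {}"
    "\<And>x. x \<in> carrier R \<Longrightarrow> x \<notin> Q \<Longrightarrow> \<exists>q\<in>Q. \<exists>r\<in>carrier R. q \<oplus> x \<otimes> r \<in> W"
proof -
  obtain Q where Q: "ideal Q R" "I \<subseteq> Q" "Q \<inter> W = {}"
    and meets: "\<And>x. x \<in> carrier R \<Longrightarrow> x \<notin> Q \<Longrightarrow> \<exists>q\<in>Q. \<exists>r\<in>carrier R. q \<oplus> x \<otimes> r \<in> W"
    using ideal_avoiding[OF assms(1,2)] by metis
  note I = ideal_closed[OF Q(1)]
  have "primeideal Q R"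
  proof (rule primeidealI[OF Q(1) cring_axioms])
    show "carrier R \<noteq> Q" using Q(3) assms(3,4) by auto
    fix x y assume xy: "x \<in> carrier R" "y \<in> carrier R" "x \<otimes> y \<in> Q"
    show "x \<in> Q \<or> y \<in> Q"
    proof (rule ccontr)
      assume "\<not> (x \<in> Q \<or> y \<in> Q)"
      then obtain q r q' r' where *: "q \<in> Q" "q' \<in> Q" "q \<oplus> x \<otimes> r \<in> W" "q' \<oplus> y \<otimes> r' \<in> W"
        and r: "r \<in> carrier R" "r' \<in> carrier R" using meets xy by metis
      have q: "q \<in> carrier R" "q' \<in> carrier R" using * I(1) by auto
      \<comment> \<open>Every term of the expansion contains q, q' or x y, so a product of two
        elements of \<open>W\<close> would fall into \<open>Q\<close>.\<close>
      have "(q \<oplus> x \<otimes> r) \<otimes> (q' \<oplus> y \<otimes> r')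
        = q \<otimes> (q' \<oplus> y \<otimes> r') \<oplus> (q' \<otimes> (x \<otimes> r) \<oplus> (x \<otimes> y) \<otimes> (r \<otimes> r'))"
        using xy q r by (simp add: ring_normal)
      also have "\<dots> \<in> Q" using I * q r xy by auto
      finally show False using mult[OF *(3,4)] Q(3) by auto
    qed
  qed
  then show thesis by (rule that[OF _ Q(2,3) meets])
qed

lemma one_notin_proper:
  "primeideal Q R \<Longrightarrow> \<one> \<notin> Q" "maximalideal Q R \<Longrightarrow> \<one> \<notin> Q"
  by (auto simp: primeideal_def primeideal_axioms_def maximalideal_def maximalideal_axioms_def
      dest: ideal.one_imp_carrier)

lemma maximal_inverse:
  assumes "maximalideal M R" and "x \<in> carrier R" and "x \<notin> M"
  obtains y where "y \<in> carrier R" "\<one> \<ominus> x \<otimes> y \<in> M"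
proof -
  have M: "ideal M R" using assms(1) by (simp add: maximalideal_def)
  note I = ideal_closed[OF M]
  let ?J = "{q \<oplus> x \<otimes> r | q r. q \<in> M \<and> r \<in> carrier R}"
  note J = ideal_adjoin[OF M assms(2)]
  have "?J = M \<or> ?J = carrier R"
    using maximalideal.I_maximal[OF assms(1) J(1,2)] ideal_closed(1)[OF J(1)] by blast
  then have "\<one> \<in> ?J" using J(3) assms(3) by auto
  then obtain q r where *: "q \<in> M" "r \<in> carrier R" "\<one> = q \<oplus> x \<otimes> r" by auto
  have q: "q \<in> carrier R" "x \<in> carrier R" "r \<in> carrier R" using * I(1) assms by auto
  have "\<one> \<ominus> x \<otimes> r = q"
    unfolding *(3) using q by (simp add: ring_normal)
  then show thesis using that[of r] * by auto
qed

lemma exists_maximal: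
  assumes "ideal I R" and "\<one> \<notin> I"
  obtains M where "maximalideal M R" "I \<subseteq> M"
proof -
  obtain Q where Q: "ideal Q R" "I \<subseteq> Q" "Q \<inter> {\<one>} = {}"
    and meets: "\<And>x. x \<in> carrier R \<Longrightarrow> x \<notin> Q \<Longrightarrow> \<exists>q\<in>Q. \<exists>r\<in>carrier R. q \<oplus> x \<otimes> r \<in> {\<one>}"
    by (rule ideal_avoiding[OF assms(1), of "{\<one>}"]) (use assms(2) in auto)
  have "maximalideal Q R"
  proof (rule maximalidealI[OF Q(1)])
    show "carrier R \<noteq> Q" using Q(3) by auto
    fix J assume J: "ideal J R" "Q \<subseteq> J" "J \<subseteq> carrier R"
    note IJ = ideal_closed[OF J(1)]
    show "J = Q \<or> J = carrier R"
    proof (rule disjCI)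
      assume "J \<noteq> carrier R"
      then have "\<one> \<notin> J" using ideal.one_imp_carrier[OF J(1)] by auto
      show "J = Q"
      proof (rule ccontr)
        assume "J \<noteq> Q"
        then obtain x where x: "x \<in> J" "x \<notin> Q" using J by auto
        have "x \<in> carrier R" using IJ(1) x(1) by (rule subsetD)
        then obtain q r where qr: "q \<in> Q" "r \<in> carrier R" "q \<oplus> x \<otimes> r = \<one>"
          using meets x(2) by fastforce
        have "q \<in> J" using qr(1) J(2) by (rule rev_subsetD)
        then have "\<one> \<in> J" using IJ(3)[OF _ IJ(7)[OF x(1) qr(2)], of q] qr(3) by simp
        then show False using \<open>\<one> \<notin> J\<close> by simp
      qed
    qed
  qed
  then show thesis by (rule that[OF _ Q(2)])
qed

lemma UnitsI_maximal:
  assumes "x \<in> carrier R" and "\<And>M. maximalideal M R \<Longrightarrow> x \<notin> M"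
  shows "x \<in> Units R"
proof (rule ccontr)
  assume nu: "x \<notin> Units R"
  have "\<one> \<notin> PIdl x"
  proof
    assume "\<one> \<in> PIdl x"
    then obtain r where "r \<in> carrier R" "\<one> = r \<otimes> x" by (auto simp: cgenideal_def)
    then show False using nu assms(1) m_comm by (auto simp: Units_def)
  qed
  then obtain M where "maximalideal M R" "PIdl x \<subseteq> M"
    using exists_maximal[OF cgenideal_ideal[OF assms(1)]] by auto
  moreover have "x \<in> PIdl x" by (rule cgenideal_self[OF assms(1)])
  ultimately show False using assms(2)[of M] by auto
qed

lemma Units_notin_maximal:
  assumes "u \<in> Units R" and "ideal M R" and "\<one> \<notin> M"
  shows "u \<notin> M"
proof
  assume "u \<in> M"
  then have "inv u \<otimes> u \<in> M" using ideal_closed(6)[OF assms(2)] assms(1) by blast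
  then show False using Units_l_inv[OF assms(1)] assms(3) by simp
qed

end

section \<open>Strongly local extensions of semilocal rings\<close>

context cring
begin

text \<open>The gate through which the hypothesis on units enters every later argument: y is reached
  as (1 + y) - 1, where 1 + y is a unit.\<close>

lemma Units_sub_imp_mem:
  assumes "subring K R" and "Units R \<subseteq> K"
    and "y \<in> carrier R" and "\<And>M. maximalideal M R \<Longrightarrow> \<one> \<oplus> y \<notin> M"
  shows "y \<in> K"
proof -
  have "\<one> \<oplus> y \<in> K" using UnitsI_maximal[of "\<one> \<oplus> y"] assms(2-4) by auto
  then have "\<ominus> \<one> \<oplus> (\<one> \<oplus> y) \<in> K" using subringE[OF assms(1)] by auto
  moreover have "\<ominus> \<one> \<oplus> (\<one> \<oplus> y) = y"
    using assms(3) by (simp add: r_neg1)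
  ultimately show ?thesis by simp
qed

lemma jacobson_sub:
  assumes "subring K R" and "Units R \<subseteq> K"
    and "y \<in> carrier R" and "\<And>M. maximalideal M R \<Longrightarrow> y \<in> M"
  shows "y \<in> K"
proof (rule Units_sub_imp_mem[OF assms(1-3)])
  fix M assume M: "maximalideal M R"
  then have I: "ideal M R" by (simp add: maximalideal_def)
  have y: "y \<in> carrier R" by fact
  have "\<one> = (\<one> \<oplus> y) \<ominus> y"
    using y by (simp add: ring_normal)
  then show "\<one> \<oplus> y \<notin> M"
    using ideal_closed(5)[OF I, of "\<one> \<oplus> y" y] one_notin_proper(2)[OF M] assms(4)[OF M] by auto
qed

text \<open>Chinese remaindering, one ideal at a time: s is multiplied by x y, where x lies in the
  new ideal but not in \<open>M\<close> and y inverts x modulo \<open>M\<close>. The residue 1 at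
  \<open>M\<close> survives, and the old memberships are kept.\<close>

lemma separate_maximal:
  assumes "finite A" and "maximalideal M R" and "\<And>N. N \<in> A \<Longrightarrow> maximalideal N R" and "M \<notin> A"
  shows "\<exists>s\<in>carrier R. \<one> \<ominus> s \<in> M \<and> (\<forall>N\<in>A. s \<in> N)"
  using assms(1,3,4)
proof (induction A)
  case empty
  have "ideal M R" using assms(2) by (simp add: maximalideal_def)
  then have "\<one> \<ominus> \<one> \<in> M" using ideal_closed(2) by (simp add: a_minus_def r_neg)
  then show ?case by (intro bexI[of _ \<one>]) auto
next
  case (insert N A)
  then obtain s where s: "s \<in> carrier R" "\<one> \<ominus> s \<in> M" "\<forall>N\<in>A. s \<in> N" by auto
  have id: "ideal N' R" if "maximalideal N' R" for N' using that by (simp add: maximalideal_def)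
  have N: "maximalideal N R" using insert by auto
  have "\<not> N \<subseteq> M"
    using maximalideal.I_maximal[OF N id[OF assms(2)]] insert.prems(2)
      ideal_closed(1)[OF id[OF assms(2)]] maximalideal.I_notcarr[OF assms(2)] by auto
  then obtain x where x: "x \<in> N" "x \<notin> M" by auto
  have xc: "x \<in> carrier R" using ideal_closed(1)[OF id[OF N]] x by auto
  obtain y where y: "y \<in> carrier R" "\<one> \<ominus> x \<otimes> y \<in> M" using maximal_inverse[OF assms(2) xc x(2)] .
  have s1: "s \<in> carrier R" by fact
  have y1: "y \<in> carrier R" by fact
  have "\<one> \<ominus> s \<otimes> (x \<otimes> y) = (\<one> \<ominus> s) \<oplus> s \<otimes> (\<one> \<ominus> x \<otimes> y)"
    using s1 xc y1 by (simp add: ring_normal)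
  then have "\<one> \<ominus> s \<otimes> (x \<otimes> y) \<in> M"
    using ideal_closed(3,6)[OF id[OF assms(2)]] s y by auto
  moreover have "s \<otimes> (x \<otimes> y) \<in> N" using ideal_closed(6,7)[OF id[OF N]] s1 y1 x by auto
  moreover have "s \<otimes> (x \<otimes> y) \<in> N'" if "N' \<in> A" for N'
    using ideal_closed(7)[OF id] that insert.prems(1) s(3) xc y1 by auto
  ultimately show ?case using s1 xc y1 by (intro bexI[of _ "s \<otimes> (x \<otimes> y)"]) auto
qed

text \<open>The element \<open>c\<close> stands for a residue class at \<open>M\<close> other than 0
  and 1. It is what allows every z to be split into two elements that avoid the class of -1.\<close>

lemma separating_conductor:
  assumes K: "subring K R" "Units R \<subseteq> K" and M: "maximalideal M R"
    and c: "c \<in> carrier R" "c \<notin> M" "\<one> \<ominus> c \<notin> M"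
    and s: "s \<in> carrier R" "\<one> \<ominus> s \<in> M" "\<And>N. maximalideal N R \<Longrightarrow> N \<noteq> M \<Longrightarrow> s \<in> N"
    and z: "z \<in> carrier R"
  shows "s \<otimes> z \<in> K"
proof -
  have id: "ideal N' R" if "maximalideal N' R" for N' using that by (simp add: maximalideal_def)
  note I = ideal_closed[OF id[OF M]]
  have generic: "s \<otimes> z \<in> K" if z: "z \<in> carrier R" "\<one> \<oplus> z \<notin> M" for z
  proof (rule Units_sub_imp_mem[OF K])
    show "s \<otimes> z \<in> carrier R" using s z by auto
    fix N assume N: "maximalideal N R"
    show "\<one> \<oplus> s \<otimes> z \<notin> N"
    proof
      assume *: "\<one> \<oplus> s \<otimes> z \<in> N"
      have sz: "s \<in> carrier R" "z \<in> carrier R" by fact+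
      show False
      proof (cases "N = M")
        case True
        have "\<one> \<oplus> z = (\<one> \<oplus> s \<otimes> z) \<oplus> (\<one> \<ominus> s) \<otimes> z"
          using sz by (simp add: ring_normal)
        then show False using I(3,7) * True s z by auto
      next
        case False
        have "\<one> = (\<one> \<oplus> s \<otimes> z) \<ominus> s \<otimes> z"
          using sz by (simp add: ring_normal)
        then show False using ideal_closed(5,7)[OF id[OF N]] * s(3)[OF N False] sz
            one_notin_proper(2)[OF N] by metis
      qed
    qed
  qed
  show ?thesis
  proof (cases "\<one> \<oplus> z \<in> M")
    case True
    \<comment> \<open>The splitting is z = -c + (z + c). The first part avoids the class of -1
      because 1 - c is outside \<open>M\<close>; for the second part 1 + z + c is congruent to
      c.\<close>
    have 1: "c \<in> carrier R" "z \<in> carrier R" "s \<in> carrier R" by fact+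
    have "\<one> \<oplus> \<ominus> c \<notin> M" using c(3) by (simp add: a_minus_def)
    moreover have "c = (\<one> \<oplus> (z \<oplus> c)) \<ominus> (\<one> \<oplus> z)"
      using 1 by (simp add: ring_normal)
    then have "\<one> \<oplus> (z \<oplus> c) \<notin> M" using I(5) True c(2) by metis
    ultimately have "s \<otimes> (\<ominus> c) \<in> K" "s \<otimes> (z \<oplus> c) \<in> K" using generic 1 by auto
    moreover have "s \<otimes> z = s \<otimes> (\<ominus> c) \<oplus> s \<otimes> (z \<oplus> c)"
      using 1 by (simp add: ring_normal)
    ultimately show ?thesis using subringE(7)[OF K(1)] by auto
  next
    case False
    then show ?thesis using generic z by auto
  qed
qed

text \<open>Since e is 0 or 1 modulo each maximal ideal, it is idempotent modulo the Jacobson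
  radical, though in general not in the ring itself. The induction also asks e to vanish at all
  maximal ideals outside the current set, so that adding the separator of a new one changes the
  residue only there.\<close>

lemma exists_conductor_idempotent:
  assumes K: "subring K R" "Units R \<subseteq> K" and fin: "finite {M. maximalideal M R}"
  obtains e where "e \<in> carrier R" "\<And>z. z \<in> carrier R \<Longrightarrow> e \<otimes> z \<in> K"
    "\<And>M. maximalideal M R \<Longrightarrow>
      \<one> \<ominus> e \<in> M \<or> e \<in> M \<and> (\<forall>x\<in>carrier R. x \<in> M \<or> \<one> \<ominus> x \<in> M)"
proof -
  \<comment> \<open>These are the maximal ideals with at least three residue classes, those of 0, 1
    and c.\<close>
  define F where "F = {M. maximalideal M R \<and> (\<exists>c\<in>carrier R. c \<notin> M \<and> \<one> \<ominus> c \<notin> M)}"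
  have id: "ideal N' R" if "maximalideal N' R" for N' using that by (simp add: maximalideal_def)
  have "\<exists>e\<in>carrier R. (\<forall>z\<in>carrier R. e \<otimes> z \<in> K) \<and> (\<forall>M\<in>A. \<one> \<ominus> e \<in> M) \<and>
      (\<forall>M. maximalideal M R \<and> M \<notin> A \<longrightarrow> e \<in> M)" if "finite A" "A \<subseteq> F" for A
    using that
  proof (induction A)
    case empty
    show ?case using subringE(2)[OF K(1)] ideal_closed(2)[OF id] by (intro bexI[of _ \<zero>]) auto
  next
    case (insert M A)
    then obtain e where e: "e \<in> carrier R" "\<And>z. z \<in> carrier R \<Longrightarrow> e \<otimes> z \<in> K"
      "\<And>M. M \<in> A \<Longrightarrow> \<one> \<ominus> e \<in> M" "\<And>M. maximalideal M R \<Longrightarrow> M \<notin> A \<Longrightarrow> e \<in> M" by auto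
    obtain c where M: "maximalideal M R" and c: "c \<in> carrier R" "c \<notin> M" "\<one> \<ominus> c \<notin> M"
      using insert.prems by (auto simp: F_def)
    obtain s where s: "s \<in> carrier R" "\<one> \<ominus> s \<in> M" "\<forall>N\<in>{M. maximalideal M R} - {M}. s \<in> N"
      using separate_maximal[of "{M. maximalideal M R} - {M}", OF finite_Diff[OF fin] M]
      by (metis (no_types, lifting) DiffD1 DiffD2 insertI1 mem_Collect_eq)
    have s3: "s \<in> N" if "maximalideal N R" "N \<noteq> M" for N using s that by auto
    note sK = separating_conductor[OF K M c s(1,2) s3]
    have es: "e \<in> carrier R" "s \<in> carrier R" by fact+
    have 1: "\<one> \<ominus> (e \<oplus> s) = (\<one> \<ominus> e) \<ominus> s" "\<one> \<ominus> (e \<oplus> s) = (\<one> \<ominus> s) \<ominus> e"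
      using es by (simp_all add: ring_normal)
    have "(e \<oplus> s) \<otimes> z \<in> K" if "z \<in> carrier R" for z
      using e(2)[OF that] sK[OF _ _ that] subringE(7)[OF K(1)] that es by (auto simp: l_distr)
    moreover have "\<one> \<ominus> (e \<oplus> s) \<in> N" if "N \<in> insert M A" for N
    proof (cases "N = M")
      case True
      then show ?thesis
        unfolding 1(2) using s(2) e(4)[OF M insert.hyps(2)] ideal_closed(5)[OF id[OF M]] by auto
    next
      case False
      then have N: "N \<in> A" "maximalideal N R" using that insert.prems by (auto simp: F_def)
      show ?thesis
        unfolding 1(1) using s3[OF N(2) False] e(3)[OF N(1)] ideal_closed(5)[OF id[OF N(2)]] by auto
    qed
    moreover have "e \<oplus> s \<in> N" if "maximalideal N R" "N \<notin> insert M A" for N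
      using ideal_closed(3)[OF id] e(4) s3 that by auto
    ultimately show ?case using es by (intro bexI[of _ "e \<oplus> s"]) auto
  qed
  moreover have "finite F" using fin by (rule rev_finite_subset) (auto simp: F_def)
  ultimately obtain e where "e \<in> carrier R" "\<And>z. z \<in> carrier R \<Longrightarrow> e \<otimes> z \<in> K"
    "\<And>M. M \<in> F \<Longrightarrow> \<one> \<ominus> e \<in> M" "\<And>M. maximalideal M R \<Longrightarrow> M \<notin> F \<Longrightarrow> e \<in> M"
    by (metis order_refl)
  then show thesis using that[of e] unfolding F_def by blast
qed

end

definition jacobson_radical :: "('a, 'b) ring_scheme \<Rightarrow> 'a set" where
  "jacobson_radical R = {x \<in> carrier R. \<forall>M. maximalideal M R \<longrightarrow> x \<in> M}"

section \<open>Ideals of a subring\<close>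

context cring
begin

text \<open>Not true by definition: negation in the subring is chosen among the elements of
  \<open>K\<close>. Uniqueness of additive inverses identifies it with negation in the big
  ring.\<close>

lemma subring_a_minus:
  assumes "subring K R" and "x \<in> K" and "y \<in> K"
  shows "x \<ominus>\<^bsub>R\<lparr>carrier := K\<rparr>\<^esub> y = x \<ominus> y"
proof -
  note Ks = subringE[OF assms(1)]
  interpret K: cring "R\<lparr>carrier := K\<rparr>"
    using subcring_iff[OF Ks(1)] subcringI'[OF assms(1)] by simp
  have "\<ominus> y \<in> K" "\<ominus> y \<oplus> y = \<zero>" using Ks(1,5) assms(3) l_neg by auto
  then have "\<ominus>\<^bsub>R\<lparr>carrier := K\<rparr>\<^esub> y = \<ominus> y"
    using K.minus_equality[of "\<ominus> y" y] assms(3) by simp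
  then show ?thesis by (simp add: a_minus_def)
qed

text \<open>Restates closure with the operations of the big ring, so that elements of both rings can
  occur in one identity.\<close>

lemma subring_ideal_closed:
  assumes "subring K R" and "ideal P (R\<lparr>carrier := K\<rparr>)"
  shows "P \<subseteq> K" and "\<zero> \<in> P"
    and "\<And>a b. a \<in> P \<Longrightarrow> b \<in> P \<Longrightarrow> a \<oplus> b \<in> P"
    and "\<And>a b. a \<in> P \<Longrightarrow> b \<in> P \<Longrightarrow> a \<ominus> b \<in> P"
    and "\<And>a r. a \<in> P \<Longrightarrow> r \<in> K \<Longrightarrow> r \<otimes> a \<in> P"
    and "\<And>a r. a \<in> P \<Longrightarrow> r \<in> K \<Longrightarrow> a \<otimes> r \<in> P"
proof -
  note Ks = subringE[OF assms(1)]
  interpret K: cring "R\<lparr>carrier := K\<rparr>"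
    using subcring_iff[OF Ks(1)] subcringI'[OF assms(1)] by simp
  note P = K.ideal_closed[OF assms(2), simplified]
  show "P \<subseteq> K" "\<zero> \<in> P" by (rule P)+
  show add: "a \<oplus> b \<in> P" if "a \<in> P" "b \<in> P" for a b using P(3)[OF that] .
  show mult: "r \<otimes> a \<in> P" "a \<otimes> r \<in> P" if "a \<in> P" "r \<in> K" for a r
    using P(6,7)[OF that] .
  show "a \<ominus> b \<in> P" if ab: "a \<in> P" "b \<in> P" for a b
  proof -
    have c: "a \<in> carrier R" "b \<in> carrier R" using ab P(1) Ks(1) by auto
    have "a \<ominus> b = a \<oplus> (\<ominus> \<one>) \<otimes> b" using c by (simp add: ring_normal)
    then show ?thesis using add mult(1)[OF ab(2)] Ks(3,5) ab(1) by auto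
  qed
qed

lemma subring_maximalideal:
  assumes "subring K R" and "maximalideal P (R\<lparr>carrier := K\<rparr>)"
  shows "ideal P (R\<lparr>carrier := K\<rparr>)" and "\<one> \<notin> P"
    and "\<And>x y. x \<in> K \<Longrightarrow> y \<in> K \<Longrightarrow> x \<otimes> y \<in> P \<Longrightarrow> x \<in> P \<or> y \<in> P"
    and "\<And>x. x \<in> K \<Longrightarrow> x \<notin> P \<Longrightarrow> \<exists>y\<in>K. \<one> \<ominus> x \<otimes> y \<in> P"
proof -
  note Ks = subringE[OF assms(1)]
  interpret K: cring "R\<lparr>carrier := K\<rparr>"
    using subcring_iff[OF Ks(1)] subcringI'[OF assms(1)] by simp
  show id: "ideal P (R\<lparr>carrier := K\<rparr>)" using assms(2) by (simp add: maximalideal_def)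
  show "\<one> \<notin> P" using K.one_notin_proper(2)[OF assms(2)] by simp
  have "primeideal P (R\<lparr>carrier := K\<rparr>)" using K.maximalideal_prime[OF assms(2)] .
  then show "x \<in> P \<or> y \<in> P" if "x \<in> K" "y \<in> K" "x \<otimes> y \<in> P" for x y
    using primeideal.I_prime[of P "R\<lparr>carrier := K\<rparr>" x y] that by auto
  show "\<exists>y\<in>K. \<one> \<ominus> x \<otimes> y \<in> P" if x: "x \<in> K" "x \<notin> P" for x
  proof -
    obtain y where y: "y \<in> K" "\<one> \<ominus>\<^bsub>R\<lparr>carrier := K\<rparr>\<^esub> x \<otimes> y \<in> P"
      using K.maximal_inverse[OF assms(2), of x] x by auto
    then have "\<one> \<ominus> x \<otimes> y \<in> P"
      using subring_a_minus[OF assms(1) Ks(3) Ks(6)[OF x(1) y(1)]] by simp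
    then show ?thesis using y(1) by blast
  qed
qed

lemma ideal_jacobson_radical:
  assumes "x \<in> jacobson_radical R" and "r \<in> carrier R"
  shows "x \<otimes> r \<in> jacobson_radical R"
  using assms ideal_closed(7) by (auto simp: jacobson_radical_def maximalideal_def)

end

section \<open>Consequences of the conductor element \<open>e\<close>\<close>

locale strongly_local_extension = cring R for R (structure) +
  fixes K e
  assumes subring_K: "subring K R" and Units_K: "Units R \<subseteq> K"
    and finite_maximal: "finite {M. maximalideal M R}"
    and e_closed: "e \<in> carrier R"
    and e_conductor: "z \<in> carrier R \<Longrightarrow> e \<otimes> z \<in> K"
    and e_cases: "maximalideal M R \<Longrightarrow>
      \<one> \<ominus> e \<in> M \<or> e \<in> M \<and> (\<forall>x\<in>carrier R. x \<in> M \<or> \<one> \<ominus> x \<in> M)"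
begin

lemma K_closed: "K \<subseteq> carrier R" "\<zero> \<in> K" "\<one> \<in> K"
  "x \<in> K \<Longrightarrow> \<ominus> x \<in> K" "x \<in> K \<Longrightarrow> y \<in> K \<Longrightarrow> x \<oplus> y \<in> K"
  "x \<in> K \<Longrightarrow> y \<in> K \<Longrightarrow> x \<ominus> y \<in> K" "x \<in> K \<Longrightarrow> y \<in> K \<Longrightarrow> x \<otimes> y \<in> K"
  using subringE[OF subring_K] by (auto simp: a_minus_def)

lemma jacobson_radical_sub: "jacobson_radical R \<subseteq> K"
  using jacobson_sub[OF subring_K Units_K] by (auto simp: jacobson_radical_def)

lemma e_in_K: "e \<in> K"
  using e_conductor[of \<one>] e_closed by simp

text \<open>Checked at each maximal ideal: either 1 - e vanishes there and so does d, or e vanishes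
  and d has the residue of b, which is then 0 or 1.\<close>

lemma complement_idempotent:
  assumes b: "b \<in> carrier R"
  defines "d \<equiv> (\<one> \<ominus> e) \<otimes> b"
  shows "d \<otimes> d \<ominus> d \<in> jacobson_radical R"
proof -
  have e: "e \<in> carrier R" by (rule e_closed)
  have d: "d \<in> carrier R" using b e by (simp add: d_def)
  have "d \<otimes> d \<ominus> d \<in> M" if M: "maximalideal M R" for M
  proof -
    have id: "ideal M R" using M by (simp add: maximalideal_def)
    have eq: "d \<otimes> d \<ominus> d = d \<otimes> (d \<ominus> \<one>)" using d by (simp add: ring_normal)
    have "d \<in> M \<or> d \<ominus> \<one> \<in> M"
    proof (cases "\<one> \<ominus> e \<in> M")
      case True
      then show ?thesis using ideal_closed(7)[OF id] b by (simp add: d_def)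
    next
      case False
      then have eM: "e \<in> M" and "b \<in> M \<or> \<one> \<ominus> b \<in> M" using e_cases[OF M] b by auto
      then show ?thesis
      proof (elim disjE)
        assume "b \<in> M"
        then show ?thesis using ideal_closed(6)[OF id] e by (simp add: d_def)
      next
        assume *: "\<one> \<ominus> b \<in> M"
        have "d \<ominus> \<one> = \<ominus> (\<one> \<ominus> b) \<ominus> e \<otimes> b"
          unfolding d_def using b e by (simp add: ring_normal)
        then show ?thesis using ideal_closed(4,5,7)[OF id] * eM b by simp
      qed
    qed
    then show ?thesis using ideal_closed(6,7)[OF id] d unfolding eq by auto
  qed
  then show ?thesis using d by (simp add: jacobson_radical_def)
qed

text \<open>With d = (1 - e) b one has b = e b + d^2 - (d^2 - d). The first term lies in
  \<open>K\<close> by the choice of e, the last in the Jacobson radical, and d^2 = (1 - e)^2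
  b^2.\<close>

lemma seminormal_square:
  assumes b: "b \<in> carrier R" and "b \<otimes> b \<in> K"
  shows "b \<in> K"
proof -
  have e: "e \<in> carrier R" by (rule e_closed)
  let ?d = "(\<one> \<ominus> e) \<otimes> b"
  have "?d \<otimes> ?d \<ominus> ?d \<in> K" using complement_idempotent[OF b] jacobson_radical_sub by auto
  moreover have "(\<one> \<ominus> e) \<otimes> (\<one> \<ominus> e) \<otimes> (b \<otimes> b) \<in> K"
    using K_closed e_in_K assms by auto
  moreover have "b = e \<otimes> b \<oplus> ((\<one> \<ominus> e) \<otimes> (\<one> \<ominus> e) \<otimes> (b \<otimes> b) \<ominus> (?d \<otimes> ?d \<ominus> ?d))"
    using b e by (simp add: ring_normal)
  ultimately show ?thesis using K_closed(5,6) e_conductor[OF b] by metis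
qed

text \<open>The elements c = e b and j = d^2 - d lie in \<open>K\<close>, and d = b - c. Expanding
  (b - c)^2 - (b - c) - j = 0 gives a monic equation of degree two for b.\<close>

lemma quadratic_over_K:
  assumes b: "b \<in> carrier R"
  shows "\<exists>r\<in>K. \<exists>r'\<in>K. b \<otimes> b \<oplus> (r \<otimes> b \<oplus> r') = \<zero>"
proof -
  define c where "c = e \<otimes> b"
  define d where "d = (\<one> \<ominus> e) \<otimes> b"
  define j where "j = d \<otimes> d \<ominus> d"
  have e: "e \<in> carrier R" by (rule e_closed)
  have c: "c \<in> K" using e_conductor[OF b] by (simp add: c_def)
  have j: "j \<in> K" using complement_idempotent[OF b] jacobson_radical_sub by (auto simp: j_def d_def)
  have cc: "c \<in> carrier R" "j \<in> carrier R" using c j K_closed(1) by auto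
  have d: "d = b \<ominus> c" unfolding c_def d_def using b e by (simp add: ring_normal)
  have "b \<otimes> b \<oplus> ((\<ominus> c \<ominus> c \<ominus> \<one>) \<otimes> b \<oplus> (c \<otimes> c \<oplus> c \<ominus> j)) = \<zero>"
    unfolding j_def d using b cc by (simp add: ring_normal)
  moreover have "\<ominus> c \<ominus> c \<ominus> \<one> \<in> K" "c \<otimes> c \<oplus> c \<ominus> j \<in> K" using K_closed c j by auto
  ultimately show ?thesis by blast
qed

text \<open>A prime \<open>Q\<close> need not contain the Jacobson radical. If an element of the
  radical, or e, lies outside \<open>Q\<close>, it can be taken as t, because it multiplies b into
  \<open>K\<close>. Otherwise b is congruent to (1 - e) b modulo \<open>Q\<close>, hence to 0 or
  1.\<close>

lemma residually_surjective:
  assumes Q: "primeideal Q R" and b: "b \<in> carrier R"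
  shows "\<exists>a\<in>K. \<exists>t\<in>K - Q. t \<otimes> b \<ominus> a \<in> Q"
proof -
  have id: "ideal Q R" using Q by (simp add: primeideal_def)
  have e: "e \<in> carrier R" by (rule e_closed)
  have zero: "x \<ominus> x \<in> Q" if "x \<in> carrier R" for x
    using that ideal_closed(2)[OF id] by (simp add: a_minus_def r_neg)
  consider j where "j \<in> jacobson_radical R" "j \<notin> Q" | "e \<notin> Q" | "jacobson_radical R \<subseteq> Q" "e \<in> Q"
    by blast
  then show ?thesis
  proof cases
    case 1
    then have "j \<otimes> b \<in> K" "j \<in> K" "j \<otimes> b \<in> carrier R"
      using ideal_jacobson_radical[OF _ b] jacobson_radical_sub K_closed(1) by auto
    then show ?thesis using 1 zero by blast
  next
    case 2
    then show ?thesis using e_conductor[OF b] e_in_K zero e b by blast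
  next
    case 3
    let ?d = "(\<one> \<ominus> e) \<otimes> b"
    have d: "?d \<in> carrier R" using e b by simp
    have one: "\<one> \<in> K - Q" using K_closed(3) one_notin_proper(1)[OF Q] by simp
    have "?d \<otimes> (?d \<ominus> \<one>) = ?d \<otimes> ?d \<ominus> ?d" using e b by (simp add: ring_normal)
    then have "?d \<otimes> (?d \<ominus> \<one>) \<in> Q" using complement_idempotent[OF b] 3(1) by auto
    then have "?d \<in> Q \<or> ?d \<ominus> \<one> \<in> Q" using primeideal.I_prime[OF Q d] d by auto
    then show ?thesis
    proof (elim disjE)
      assume *: "?d \<in> Q"
      have "\<one> \<otimes> b \<ominus> \<zero> = ?d \<oplus> e \<otimes> b" using e b by (simp add: ring_normal)
      also have "\<dots> \<in> Q" using * ideal_closed(3,7)[OF id] 3(2) b by simp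
      finally have "\<one> \<otimes> b \<ominus> \<zero> \<in> Q" .
      then show ?thesis using one K_closed(2) by blast
    next
      assume *: "?d \<ominus> \<one> \<in> Q"
      have "\<one> \<otimes> b \<ominus> \<one> = (?d \<ominus> \<one>) \<oplus> e \<otimes> b" using e b by (simp add: ring_normal)
      also have "\<dots> \<in> Q" using * ideal_closed(3,7)[OF id] 3(2) b by simp
      finally have "\<one> \<otimes> b \<ominus> \<one> \<in> Q" .
      then show ?thesis using one K_closed(3) by blast
    qed
  qed
qed

text \<open>By \<open>supp\<close>, every t in \<open>K\<close> that multiplies the whole big ring
  into \<open>K\<close> belongs to \<open>P\<close>; this applies to e and to the Jacobson radical.
  Modulo \<open>P\<close>, therefore, a equals (1 - e) a, which is idempotent there.\<close>

lemma residue_two: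
  assumes P: "maximalideal P (R\<lparr>carrier := K\<rparr>)"
    and supp: "\<And>t. t \<in> K - P \<Longrightarrow> \<exists>s\<in>carrier R. t \<otimes> s \<notin> K"
    and a: "a \<in> K"
  shows "a \<in> P \<or> \<one> \<ominus> a \<in> P"
proof -
  note PK = subring_maximalideal[OF subring_K P]
  note cl = subring_ideal_closed[OF subring_K PK(1)]
  have e: "e \<in> carrier R" by (rule e_closed)
  have ac: "a \<in> carrier R" using a K_closed(1) by auto
  have eP: "e \<in> P" using supp[of e] e_in_K e_conductor by auto
  have JP: "j \<in> P" if "j \<in> jacobson_radical R" for j
    using that supp[of j] ideal_jacobson_radical[OF that] jacobson_radical_sub by auto
  let ?d = "(\<one> \<ominus> e) \<otimes> a"
  have d: "?d \<in> K" using e_in_K a K_closed by auto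
  have "?d \<otimes> (?d \<ominus> \<one>) = ?d \<otimes> ?d \<ominus> ?d" using e ac by (simp add: ring_normal)
  then have "?d \<otimes> (?d \<ominus> \<one>) \<in> P" using complement_idempotent[OF ac] JP by auto
  then have "?d \<in> P \<or> ?d \<ominus> \<one> \<in> P" using PK(3)[OF d] d K_closed(3,6) by auto
  then show ?thesis
  proof (elim disjE)
    assume *: "?d \<in> P"
    have "a = ?d \<oplus> e \<otimes> a" using e ac by (simp add: ring_normal)
    then show ?thesis using * cl(3)[OF *] cl(6)[OF eP a] by metis
  next
    assume *: "?d \<ominus> \<one> \<in> P"
    have "\<one> \<ominus> a = \<zero> \<ominus> ((?d \<ominus> \<one>) \<oplus> e \<otimes> a)" using e ac by (simp add: ring_normal)
    then show ?thesis using cl(3)[OF *] cl(6)[OF eP a] cl(2,4) by metis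
  qed
qed

text \<open>Where 1 - e does not vanish the residue field has two elements, so membership in
  \<open>M\<close> fixes the residue. A coset of \<open>K\<close> is thus determined by finitely
  many bits, which is the source of FIP.\<close>

lemma same_maximal_imp_diff_in_K:
  assumes b: "b \<in> carrier R" "b' \<in> carrier R"
    and same: "\<And>M. maximalideal M R \<Longrightarrow> b \<in> M \<longleftrightarrow> b' \<in> M"
  shows "b \<ominus> b' \<in> K"
proof -
  have e: "e \<in> carrier R" by (rule e_closed)
  have "(\<one> \<ominus> e) \<otimes> (b \<ominus> b') \<in> M" if M: "maximalideal M R" for M
  proof -
    have id: "ideal M R" using M by (simp add: maximalideal_def)
    note I = ideal_closed[OF id]
    consider "\<one> \<ominus> e \<in> M" | "b \<in> M" "b' \<in> M" | "\<one> \<ominus> b \<in> M" "\<one> \<ominus> b' \<in> M"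
      using e_cases[OF M] b same[OF M] by auto
    then show ?thesis
    proof cases
      case 3
      have "(\<one> \<ominus> e) \<otimes> (b \<ominus> b') = (\<one> \<ominus> e) \<otimes> ((\<one> \<ominus> b') \<ominus> (\<one> \<ominus> b))"
        using e b by (simp add: ring_normal)
      then show ?thesis using I(5,6) 3 e by simp
    qed (use I(5,6,7) e b in auto)
  qed
  then have "(\<one> \<ominus> e) \<otimes> (b \<ominus> b') \<in> K"
    using jacobson_radical_sub e b by (auto simp: jacobson_radical_def)
  moreover have "b \<ominus> b' = e \<otimes> (b \<ominus> b') \<oplus> (\<one> \<ominus> e) \<otimes> (b \<ominus> b')"
    using e b by (simp add: ring_normal)
  ultimately show ?thesis using e_conductor[of "b \<ominus> b'"] K_closed(5) b by (metis minus_closed)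
qed

text \<open>An intermediate ring contains \<open>K\<close>, so it is a union of cosets of
  \<open>K\<close>. Since \<open>\<sigma> b\<close> determines the coset of b, the ring is recovered
  from the set of all its \<open>\<sigma> b\<close>, for which there are finitely many
  choices.\<close>

lemma finite_intermediate: "finite (intermediate_rings K R)"
proof -
  define \<sigma> where "\<sigma> b = {M. maximalideal M R \<and> b \<in> M}" for b
  have sub: "T \<subseteq> T'" if T: "T \<in> intermediate_rings K R" "T' \<in> intermediate_rings K R"
    and eq: "\<sigma> ` T \<subseteq> \<sigma> ` T'" for T T'
  proof
    fix b assume "b \<in> T"
    then have "\<sigma> b \<in> \<sigma> ` T'" using eq by blast
    then obtain b' where b': "b' \<in> T'" "\<sigma> b = \<sigma> b'" by blast
    have c: "b \<in> carrier R" "b' \<in> carrier R"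
      using T \<open>b \<in> T\<close> b' subcringE(1) by (auto simp: intermediate_rings_def)
    have "b \<in> M \<longleftrightarrow> b' \<in> M" if "maximalideal M R" for M using b'(2) that by (auto simp: \<sigma>_def)
    then have "b \<ominus> b' \<in> T'"
      using same_maximal_imp_diff_in_K[OF c] T(2) by (auto simp: intermediate_rings_def)
    moreover have "b = (b \<ominus> b') \<oplus> b'" using c by (simp add: ring_normal)
    ultimately show "b \<in> T'" using T(2) b'(1) subcringE(7)[of T' R]
      by (metis (no_types, lifting) intermediate_rings_def mem_Collect_eq)
  qed
  have "inj_on (\<lambda>T. \<sigma> ` T) (intermediate_rings K R)"
  proof (rule inj_onI)
    fix T T' assume *: "T \<in> intermediate_rings K R" "T' \<in> intermediate_rings K R" "\<sigma> ` T = \<sigma> ` T'"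
    show "T = T'" by (rule equalityI; rule sub) (use * in auto)
  qed
  moreover have "(\<lambda>T. \<sigma> ` T) ` intermediate_rings K R \<subseteq> Pow (Pow {M. maximalideal M R})"
    by (auto simp: \<sigma>_def)
  ultimately show ?thesis
    using finite_maximal by (meson finite_Pow_iff finite_subset inj_on_finite)
qed

end

lemma (in cring) exists_strongly_local_extension:
  assumes "subring K R" and "Units R \<subseteq> K" and "finite {M. maximalideal M R}"
  obtains e where "strongly_local_extension R K e"
proof (rule exists_conductor_idempotent[OF assms])
  fix e assume "e \<in> carrier R" "\<And>z. z \<in> carrier R \<Longrightarrow> e \<otimes> z \<in> K"
    "\<And>M. maximalideal M R \<Longrightarrow>
      \<one> \<ominus> e \<in> M \<or> e \<in> M \<and> (\<forall>x\<in>carrier R. x \<in> M \<or> \<one> \<ominus> x \<in> M)"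
  then have "strongly_local_extension R K e"
    by (intro strongly_local_extension.intro strongly_local_extension_axioms.intro cring_axioms assms)
  then show thesis by (rule that)
qed

section \<open>Seminormal infra-integral FIP extensions\<close>

context cring
begin

lemma nat_pow_diff_in_ideal:
  assumes "ideal Q R" and "x \<in> carrier R" and "y \<in> carrier R" and "x \<ominus> y \<in> Q"
  shows "x [^] (k::nat) \<ominus> y [^] k \<in> Q"
proof (induction k)
  case 0
  show ?case using ideal_closed(2)[OF assms(1)] by (simp add: a_minus_def r_neg)
next
  case (Suc k)
  define a where "a = x [^] k"
  define b where "b = y [^] k"
  have c: "a \<in> carrier R" "b \<in> carrier R" "x \<in> carrier R" "y \<in> carrier R"
    using assms by (auto simp: a_def b_def)
  have "a \<otimes> x \<ominus> b \<otimes> y = (a \<ominus> b) \<otimes> x \<oplus> b \<otimes> (x \<ominus> y)"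
    using c by (simp add: ring_normal)
  also have "\<dots> \<in> Q"
    using Suc assms(4) ideal_closed(3,6,7)[OF assms(1)] c by (auto simp: a_def b_def)
  finally show ?case by (simp add: a_def b_def)
qed

text \<open>The multiplicative set \<open>{x\<^sup>k + n}\<close> replaces lying over combined with the determinant trick.\<close>

lemma prime_over_avoiding:
  assumes K: "subring K R" and B: "subring B R" "K \<subseteq> B"
    and integral: "\<And>s. s \<in> carrier R \<Longrightarrow> \<exists>l. set l \<subseteq> K \<and> eval (\<one> # l) s = \<zero>"
    and N: "N \<subseteq> B" "\<zero> \<in> N" "\<And>m n. m \<in> N \<Longrightarrow> n \<in> N \<Longrightarrow> m \<oplus> n \<in> N"
      "\<And>n y. n \<in> N \<Longrightarrow> y \<in> B \<Longrightarrow> y \<otimes> n \<in> N"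
    and x: "x \<in> B" "\<And>k::nat. x [^] k \<notin> N"
  obtains Q where "primeideal Q R" "N \<subseteq> Q" "x \<notin> Q"
proof -
  note Bs = subringE[OF B(1)]
  have Nc: "n \<in> carrier R" if "n \<in> N" for n using that N(1) Bs(1) by auto
  have xc: "x \<in> carrier R" using x Bs(1) by auto
  have pow_B: "y [^] (k::nat) \<in> B" if "y \<in> B" for y k
    using that Bs(3,6) by (induction k) auto
  \<comment> \<open>Powers of x perturbed by \<open>N\<close>. A prime that avoids them all omits x;
    that it also contains \<open>N\<close> will follow from its maximality together with
    integrality.\<close>
  define W where "W = {x [^] (k::nat) \<oplus> n | k n. n \<in> N}"
  have W_B: "W \<subseteq> B" using pow_B[OF x(1)] N(1) Bs(7) by (auto simp: W_def)
  have W_add: "w \<oplus> n \<in> W" if "w \<in> W" "n \<in> N" for w n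
  proof -
    from that(1) obtain k m where w: "w = x [^] (k::nat) \<oplus> m" "m \<in> N" by (auto simp: W_def)
    then have "w \<oplus> n = x [^] k \<oplus> (m \<oplus> n)" using xc Nc that(2) by (simp add: a_assoc)
    then show ?thesis using N(3)[OF w(2) that(2)] by (auto simp: W_def)
  qed
  have one: "\<one> \<in> W" using N(2) by (auto simp: W_def intro!: exI[of _ 0] exI[of _ \<zero>])
  have mult: "v \<otimes> w \<in> W" if "v \<in> W" "w \<in> W" for v w
  proof -
    from that obtain i j m n where vw: "v = x [^] (i::nat) \<oplus> m" "w = x [^] (j::nat) \<oplus> n"
      and mn: "m \<in> N" "n \<in> N" by (auto simp: W_def)
    define a where "a = x [^] i"
    define b where "b = x [^] j"
    have ab: "a \<in> B" "b \<in> B" using pow_B[OF x(1)] by (auto simp: a_def b_def)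
    have c: "a \<in> carrier R" "b \<in> carrier R" "m \<in> carrier R" "n \<in> carrier R"
      using ab mn Nc Bs(1) by auto
    have "v \<otimes> w = a \<otimes> b \<oplus> (a \<otimes> n \<oplus> (b \<otimes> m \<oplus> m \<otimes> n))"
      unfolding vw a_def[symmetric] b_def[symmetric] using c by (simp add: ring_normal)
    moreover have "a \<otimes> b = x [^] (i + j)" using xc by (simp add: a_def b_def nat_pow_mult)
    moreover have "a \<otimes> n \<oplus> (b \<otimes> m \<oplus> m \<otimes> n) \<in> N"
      using N mn ab by (meson subsetD)
    ultimately show ?thesis by (auto simp: W_def)
  qed
  have W_pow: "w [^] (k::nat) \<in> W" if "w \<in> W" for w k
    using that one mult by (induction k) auto
  have "\<zero> \<notin> W"
  proof
    assume "\<zero> \<in> W"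
    then obtain k n where kn: "\<zero> = x [^] (k::nat) \<oplus> n" "n \<in> N" by (auto simp: W_def)
    then have "x [^] k = (\<ominus> \<one>) \<otimes> n"
      using xc Nc minus_equality[of "x [^] k" n] by (simp add: l_minus)
    also have "\<dots> \<in> N" using N(4)[OF kn(2)] Bs(3,5) by auto
    finally show False using x(2) by simp
  qed
  then have "{\<zero>} \<inter> W = {}" by simp
  moreover have "W \<subseteq> carrier R" using W_B Bs(1) by auto
  ultimately have "\<exists>Q. primeideal Q R \<and> Q \<inter> W = {} \<and>
      (\<forall>y\<in>carrier R - Q. \<exists>q\<in>Q. \<exists>r\<in>carrier R. q \<oplus> y \<otimes> r \<in> W)"
    by (rule prime_avoiding[OF zeroideal _ one]) (erule (1) mult, rule exI, rule conjI, assumption, simp)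
  then obtain Q where Q: "primeideal Q R" "Q \<inter> W = {}"
    and meets: "\<And>y. y \<in> carrier R \<Longrightarrow> y \<notin> Q \<Longrightarrow> \<exists>q\<in>Q. \<exists>r\<in>carrier R. q \<oplus> y \<otimes> r \<in> W"
    by auto
  have id: "ideal Q R" using Q(1) by (simp add: primeideal_def)
  note I = ideal_closed[OF id]
  have "N \<subseteq> Q"
  proof
    fix p assume p: "p \<in> N"
    show "p \<in> Q"
    proof (rule ccontr)
      assume "p \<notin> Q"
      \<comment> \<open>Modulo \<open>Q\<close> the product p s becomes an element w of
        \<open>W\<close>, hence of \<open>B\<close>, although s itself need not lie in
        \<open>B\<close>.\<close>
      then obtain q s where qs: "q \<in> Q" "s \<in> carrier R" and W: "q \<oplus> p \<otimes> s \<in> W"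
        using meets Nc[OF p] by blast
      define w where "w = q \<oplus> p \<otimes> s"
      have w: "w \<in> W" "w \<in> B" "w \<in> carrier R" using W W_B Bs(1) by (auto simp: w_def)
      have c: "p \<in> carrier R" "s \<in> carrier R" "q \<in> carrier R" using qs Nc[OF p] I(1) by auto
      have "p \<otimes> s \<ominus> w = \<zero> \<ominus> q" unfolding w_def using c by (simp add: ring_normal)
      then have "p \<otimes> s \<ominus> w \<in> Q" using I(2,5) qs(1) by simp
      then have pow: "(p \<otimes> s) [^] (k::nat) \<ominus> w [^] k \<in> Q" for k
        using nat_pow_diff_in_ideal[OF id _ w(3)] c by simp
      have ev: "eval l s \<in> carrier R" if "set l \<subseteq> K" for l
        using eval_in_carrier that c(2) subringE(1)[OF K] by (meson subset_trans)
      \<comment> \<open>The exponent \<open>length l\<close> exceeds the degree of the polynomial by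
        one. Each term a s^i p^m is a (p s)^i times at least one factor p, so replacing p s by w
        leaves an element of \<open>N\<close>.\<close>
      have red: "\<exists>n\<in>N. p [^] (length l) \<otimes> eval l s \<ominus> n \<in> Q" if "set l \<subseteq> K" for l
        using that
      proof (induction l)
        case Nil
        then show ?case using N(2) I(2) by (intro bexI[of _ \<zero>]) (simp_all add: a_minus_def)
      next
        case (Cons a l)
        then obtain n where n: "n \<in> N" "p [^] (length l) \<otimes> eval l s \<ominus> n \<in> Q" by auto
        let ?k = "length l"
        define P where "P = p [^] ?k"
        define S where "S = s [^] ?k"
        define V where "V = w [^] ?k"
        define v where "v = eval l s"
        have a: "a \<in> B" "a \<in> carrier R" using Cons.prems B(2) Bs(1) by auto
        have cc: "P \<in> carrier R" "S \<in> carrier R" "V \<in> carrier R" "v \<in> carrier R" "n \<in> carrier R"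
          using c w(3) ev Cons.prems Nc[OF n(1)] by (auto simp: P_def S_def V_def v_def)
        have "P \<otimes> S \<ominus> V \<in> Q"
          using pow[of ?k] c by (simp add: P_def S_def V_def nat_pow_distrib)
        moreover have "(P \<otimes> p) \<otimes> (a \<otimes> S \<oplus> v) \<ominus> ((a \<otimes> V) \<otimes> p \<oplus> p \<otimes> n)
            = (p \<otimes> a) \<otimes> (P \<otimes> S \<ominus> V) \<oplus> p \<otimes> (P \<otimes> v \<ominus> n)"
          using c cc a by (simp add: ring_normal)
        ultimately have "(P \<otimes> p) \<otimes> (a \<otimes> S \<oplus> v) \<ominus> ((a \<otimes> V) \<otimes> p \<oplus> p \<otimes> n) \<in> Q"
          using n(2) I(3,6) c a by (simp add: P_def v_def)
        moreover have "(a \<otimes> V) \<otimes> p \<oplus> p \<otimes> n \<in> N"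
          using N(3)[OF N(4)[OF p] N(4)[OF n(1)]] Bs(6)[OF a(1)] pow_B[OF w(2)] p N(1)
          by (auto simp: V_def)
        ultimately show ?case by (auto simp: P_def S_def v_def)
      qed
      \<comment> \<open>Multiplying the monic equation of s by p^m, with m the length of l, and
        replacing p s by w shows that w^m + n lies in \<open>Q\<close> for some n in
        \<open>N\<close>. But w^m + n belongs to \<open>W\<close>.\<close>
      obtain l where l: "set l \<subseteq> K" "eval (\<one> # l) s = \<zero>" using integral[OF c(2)] by auto
      obtain n where n: "n \<in> N" "p [^] (length l) \<otimes> eval l s \<ominus> n \<in> Q" using red[OF l(1)] by auto
      let ?k = "length l"
      define P where "P = p [^] ?k"
      define S where "S = s [^] ?k"
      define V where "V = w [^] ?k"
      define v where "v = eval l s"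
      have cc: "P \<in> carrier R" "S \<in> carrier R" "V \<in> carrier R" "v \<in> carrier R" "n \<in> carrier R"
        using c w(3) ev l Nc[OF n(1)] by (auto simp: P_def S_def V_def v_def)
      have "P \<otimes> S \<ominus> V \<in> Q" using pow[of ?k] c by (simp add: P_def S_def V_def nat_pow_distrib)
      moreover have "S \<oplus> v = \<zero>" using l(2) cc by (simp add: S_def v_def)
      moreover have "V \<oplus> n = P \<otimes> (S \<oplus> v) \<ominus> ((P \<otimes> S \<ominus> V) \<oplus> (P \<otimes> v \<ominus> n))"
        using cc by (simp add: ring_normal)
      ultimately have "V \<oplus> n \<in> Q" using I(2,3,5) n(2) cc by (simp add: P_def v_def)
      moreover have "V \<oplus> n \<in> W" using W_add[OF W_pow[OF w(1)] n(1)] by (simp add: V_def)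
      ultimately show False using Q(2) by auto
    qed
  qed
  moreover have "x \<in> W"
    unfolding W_def using xc N(2) by (intro CollectI exI[of _ "1::nat"] exI[of _ \<zero>]) simp
  then have "x \<notin> Q" using Q(2) by auto
  ultimately show thesis using that Q(1) by simp
qed

end

section \<open>Polynomials of bounded degree in one element\<close>

text \<open>\<open>horner R A b n\<close> consists of the sums \<open>x\<^sub>0 + x\<^sub>1 b + \<dots> + x\<^sub>n b\<^sup>n\<close> with coefficients in \<open>A\<close>.\<close>

primrec horner :: "('a, 'c) ring_scheme \<Rightarrow> 'a set \<Rightarrow> 'a \<Rightarrow> nat \<Rightarrow> 'a set" where
  "horner R A b 0 = A"
| "horner R A b (Suc n) = {x \<oplus>\<^bsub>R\<^esub> b \<otimes>\<^bsub>R\<^esub> y | x y. x \<in> A \<and> y \<in> horner R A b n}"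

lemma horner_mono: "A \<subseteq> A' \<Longrightarrow> horner R A b n \<subseteq> horner R A' b n"
  by (induction n) auto

text \<open>The coefficients form an arbitrary \<open>K\<close>-submodule because two instances are
  needed: A = K, which describes the ring K[b], and A = P for a maximal ideal P of \<open>K\<close>,
  which describes P K[b].\<close>

locale horner_module = cring R for R (structure) +
  fixes K A b
  assumes subring_K: "subring K R" and b_closed: "b \<in> carrier R"
    and A_closed: "A \<subseteq> carrier R" "\<zero> \<in> A" "\<And>x y. x \<in> A \<Longrightarrow> y \<in> A \<Longrightarrow> x \<oplus> y \<in> A"
      "\<And>r x. r \<in> K \<Longrightarrow> x \<in> A \<Longrightarrow> r \<otimes> x \<in> A"
begin

lemma horner_carrier: "horner R A b n \<subseteq> carrier R"
  using b_closed A_closed(1) by (induction n) auto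

lemma horner_zero: "\<zero> \<in> horner R A b n"
proof (induction n)
  case (Suc n)
  have "\<zero> = \<zero> \<oplus> b \<otimes> \<zero>" using b_closed by simp
  then show ?case using Suc A_closed(2) by auto
qed (simp add: A_closed)

lemma horner_add: "y \<in> horner R A b n \<Longrightarrow> z \<in> horner R A b n \<Longrightarrow> y \<oplus> z \<in> horner R A b n"
proof (induction n arbitrary: y z)
  case (Suc n)
  then obtain x y' x' z' where *: "y = x \<oplus> b \<otimes> y'" "z = x' \<oplus> b \<otimes> z'" "x \<in> A" "x' \<in> A"
    "y' \<in> horner R A b n" "z' \<in> horner R A b n" by auto
  have c: "x \<in> carrier R" "x' \<in> carrier R" "y' \<in> carrier R" "z' \<in> carrier R" "b \<in> carrier R"
    using * A_closed(1) horner_carrier b_closed by auto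
  have "y \<oplus> z = (x \<oplus> x') \<oplus> b \<otimes> (y' \<oplus> z')"
    unfolding * using c by (simp add: ring_normal)
  then show ?case using A_closed(3)[OF *(3,4)] Suc.IH[OF *(5,6)] by auto
qed (simp add: A_closed)

lemma horner_scale: "r \<in> K \<Longrightarrow> y \<in> horner R A b n \<Longrightarrow> r \<otimes> y \<in> horner R A b n"
proof (induction n arbitrary: y)
  case (Suc n)
  then obtain x y' where *: "y = x \<oplus> b \<otimes> y'" "x \<in> A" "y' \<in> horner R A b n" by auto
  have c: "r \<in> carrier R" "x \<in> carrier R" "y' \<in> carrier R" "b \<in> carrier R"
    using * A_closed(1) horner_carrier b_closed Suc.prems(1) subringE(1)[OF subring_K] by auto
  have "r \<otimes> y = r \<otimes> x \<oplus> b \<otimes> (r \<otimes> y')"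
    unfolding * using c by (simp add: ring_normal)
  then show ?case using A_closed(4)[OF Suc.prems(1) *(2)] Suc.IH[OF Suc.prems(1) *(3)] by auto
qed (simp add: A_closed)

lemma horner_Suc: "horner R A b n \<subseteq> horner R A b (Suc n)"
proof (induction n)
  case 0
  have "x = x \<oplus> b \<otimes> \<zero>" if "x \<in> A" for x using that A_closed(1) b_closed by auto
  then show ?case using A_closed(2) by auto
qed auto

lemma horner_le: "m \<le> n \<Longrightarrow> horner R A b m \<subseteq> horner R A b n"
  by (rule lift_Suc_mono_le[of "horner R A b"]) (rule horner_Suc)

lemma coefficient_in_horner: "A \<subseteq> horner R A b n"
  using horner_le[of 0 n] by simp

lemma horner_shift: "y \<in> horner R A b n \<Longrightarrow> b \<otimes> y \<in> horner R A b (Suc n)"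
proof -
  assume y: "y \<in> horner R A b n"
  then have "y \<in> carrier R" using horner_carrier by blast
  then have "b \<otimes> y = \<zero> \<oplus> b \<otimes> y" using b_closed by simp
  then show ?thesis using y A_closed(2) by auto
qed

lemma horner_top: "x \<in> A \<Longrightarrow> x \<otimes> b [^] n \<in> horner R A b n"
proof (induction n)
  case 0
  then show ?case using A_closed(1) by auto
next
  case (Suc n)
  have c: "x \<in> carrier R" "b \<in> carrier R" using Suc.prems A_closed(1) b_closed by auto
  have "x \<otimes> b [^] Suc n = b \<otimes> (x \<otimes> b [^] n)"
    using c by (simp add: m_ac)
  then show ?case using horner_shift[OF Suc.IH[OF Suc.prems]] by simp
qed

text \<open>The recursion of \<open>horner\<close> peels off the constant coefficient; reductions
  and eliminations have to reach the leading one.\<close>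

lemma horner_split:
  "y \<in> horner R A b (Suc n) \<Longrightarrow> \<exists>y'\<in>horner R A b n. \<exists>x\<in>A. y = y' \<oplus> x \<otimes> b [^] Suc n"
proof (induction n arbitrary: y)
  case 0
  then obtain x z where *: "x \<in> A" "z \<in> A" "y = x \<oplus> b \<otimes> z" by auto
  moreover have "b \<otimes> z = z \<otimes> b" using * A_closed(1) b_closed by (intro m_comm) auto
  ultimately show ?case using b_closed by auto
next
  case (Suc n)
  then obtain x z where *: "x \<in> A" "z \<in> horner R A b (Suc n)" "y = x \<oplus> b \<otimes> z"
    using horner.simps(2)[of R A b "Suc n"] by auto
  obtain z' x' where z: "z' \<in> horner R A b n" "x' \<in> A" "z = z' \<oplus> x' \<otimes> b [^] Suc n"
    using Suc.IH[OF *(2)] by auto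
  define B where "B = b [^] Suc n"
  have c: "x \<in> carrier R" "x' \<in> carrier R" "z' \<in> carrier R" "b \<in> carrier R" "B \<in> carrier R"
    using * z A_closed(1) horner_carrier b_closed by (auto simp: B_def)
  have "x \<oplus> b \<otimes> (z' \<oplus> x' \<otimes> B) = (x \<oplus> b \<otimes> z') \<oplus> x' \<otimes> (B \<otimes> b)"
    using c by (simp add: ring_normal)
  then have "y = (x \<oplus> b \<otimes> z') \<oplus> x' \<otimes> b [^] Suc (Suc n)"
    unfolding *(3) z(3) B_def by simp
  moreover have "x \<oplus> b \<otimes> z' \<in> horner R A b (Suc n)" using *(1) z(1) by auto
  ultimately show ?case using z(2) by blast
qed

lemma coefficient_times_horner:
  assumes "x \<in> A" and "y \<in> horner R K b n"
  shows "x \<otimes> y \<in> horner R A b n"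
  using assms(2)
proof (induction n arbitrary: y)
  case 0
  then have "x \<otimes> y = y \<otimes> x" using assms(1) A_closed(1) subringE(1)[OF subring_K] m_comm by auto
  then show ?case using A_closed(4) assms(1) 0 by simp
next
  case (Suc n)
  then obtain r z where *: "r \<in> K" "z \<in> horner R K b n" "y = r \<oplus> b \<otimes> z" by auto
  have K: "horner R K b n \<subseteq> carrier R"
    using subringE(1)[OF subring_K] b_closed by (induction n) auto
  have c: "r \<in> carrier R" "x \<in> carrier R" "z \<in> carrier R" "b \<in> carrier R"
    using * A_closed(1) K b_closed assms(1) subringE(1)[OF subring_K] by auto
  have "x \<otimes> y = r \<otimes> x \<oplus> b \<otimes> (x \<otimes> z)"
    unfolding * using c by (simp add: ring_normal)
  then show ?case using A_closed(4)[OF *(1) assms(1)] Suc.IH[OF *(2)] by auto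
qed

text \<open>Multiplication by b raises the degree only through the leading term x b^n. The resulting
  x b^(n+1) is brought back by the integral equation, whose coefficients lie in \<open>K\<close> and
  are scaled by x into \<open>A\<close>.\<close>

lemma horner_stable:
  assumes "b [^] Suc n \<in> horner R K b n" and "y \<in> horner R A b n"
  shows "b \<otimes> y \<in> horner R A b n"
proof (cases n)
  case 0
  then have "b \<in> horner R K b n" "y \<in> A" using assms b_closed by auto
  moreover have "b \<otimes> y = y \<otimes> b" using \<open>y \<in> A\<close> A_closed(1) b_closed by (intro m_comm) auto
  ultimately show ?thesis using coefficient_times_horner by simp
next
  case (Suc m)
  obtain y' x where *: "y' \<in> horner R A b m" "x \<in> A" "y = y' \<oplus> x \<otimes> b [^] n"
    using horner_split assms(2) unfolding Suc by blast
  define B where "B = b [^] n"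
  have c: "x \<in> carrier R" "y' \<in> carrier R" "b \<in> carrier R" "B \<in> carrier R"
    using * A_closed(1) horner_carrier b_closed by (auto simp: B_def)
  have "b \<otimes> (y' \<oplus> x \<otimes> B) = b \<otimes> y' \<oplus> x \<otimes> (B \<otimes> b)"
    using c by (simp add: ring_normal)
  then have "b \<otimes> y = b \<otimes> y' \<oplus> x \<otimes> b [^] Suc n" unfolding *(3) B_def by simp
  then show ?thesis
    using horner_add[OF _ coefficient_times_horner[OF *(2) assms(1)]] horner_shift[OF *(1)]
    by (simp add: Suc)
qed

text \<open>Makes the polynomials with coefficients in \<open>A\<close> a module over K[b]; for A =
  P this says that P K[b] is an ideal of K[b].\<close>

lemma horner_mult:
  assumes "b [^] Suc n \<in> horner R K b n" and "y \<in> horner R A b n" and "z \<in> horner R K b m"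
  shows "z \<otimes> y \<in> horner R A b n"
  using assms(3)
proof (induction m arbitrary: z)
  case 0
  then show ?case using horner_scale assms(2) by simp
next
  case (Suc m)
  then obtain r z' where *: "r \<in> K" "z' \<in> horner R K b m" "z = r \<oplus> b \<otimes> z'" by auto
  have K: "horner R K b m \<subseteq> carrier R"
    using subringE(1)[OF subring_K] b_closed by (induction m) auto
  have c: "r \<in> carrier R" "y \<in> carrier R" "z' \<in> carrier R" "b \<in> carrier R"
    using * horner_carrier K b_closed assms(2) subringE(1)[OF subring_K] by auto
  have "z \<otimes> y = r \<otimes> y \<oplus> b \<otimes> (z' \<otimes> y)"
    unfolding * using c by (simp add: ring_normal)
  then show ?case
    using horner_add[OF horner_scale[OF *(1) assms(2)] horner_stable[OF assms(1) Suc.IH[OF *(2)]]]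
    by simp
qed

end

text \<open>The hypotheses of the converse in terms of elements. In \<open>residue_two\<close> the
  support is witnessed by one s for all t at once, meaning that the class of s does not vanish in
  the localization at P.\<close>

locale infra_integral_extension = cring R for R (structure) +
  fixes K
  assumes subring_K: "subring K R" and one_not_zero: "\<one> \<noteq> \<zero>"
    and seminormal_K: "seminormal K R"
    and integral_K: "s \<in> carrier R \<Longrightarrow> \<exists>l. set l \<subseteq> K \<and> eval (\<one> # l) s = \<zero>"
    and residual: "primeideal Q R \<Longrightarrow> s \<in> carrier R \<Longrightarrow> \<exists>a\<in>K. \<exists>t\<in>K - Q. t \<otimes> s \<ominus> a \<in> Q"
    and FIP_K: "FIP K R"
    and residue_two: "maximalideal P (R\<lparr>carrier := K\<rparr>) \<Longrightarrow> s \<in> carrier R \<Longrightarrow>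
      (\<And>t. t \<in> K - P \<Longrightarrow> t \<otimes> s \<notin> K) \<Longrightarrow> a \<in> K \<Longrightarrow> a \<in> P \<or> \<one> \<ominus> a \<in> P"
begin

lemma K_closed: "K \<subseteq> carrier R" "\<zero> \<in> K" "\<one> \<in> K"
  "x \<in> K \<Longrightarrow> \<ominus> x \<in> K" "x \<in> K \<Longrightarrow> y \<in> K \<Longrightarrow> x \<oplus> y \<in> K"
  "x \<in> K \<Longrightarrow> y \<in> K \<Longrightarrow> x \<ominus> y \<in> K" "x \<in> K \<Longrightarrow> y \<in> K \<Longrightarrow> x \<otimes> y \<in> K"
  using subringE[OF subring_K] by (auto simp: a_minus_def)

text \<open>The elements whose residue is the same at all primes of \<open>R\<close> over a given maximal ideal of
  \<open>K\<close> with residue field of order two.\<close>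

definition residually_constant :: "'a set" where
  "residually_constant = {s \<in> carrier R. \<forall>P. maximalideal P (R\<lparr>carrier := K\<rparr>) \<and> (\<forall>a\<in>K. a \<in> P \<or> \<one> \<ominus> a \<in> P) \<longrightarrow>
     (\<exists>r\<in>K. \<forall>Q. primeideal Q R \<and> P \<subseteq> Q \<longrightarrow> s \<ominus> r \<in> Q)}"

lemma residually_constantI:
  assumes "s \<in> carrier R"
    and "\<And>P. maximalideal P (R\<lparr>carrier := K\<rparr>) \<Longrightarrow> \<forall>a\<in>K. a \<in> P \<or> \<one> \<ominus> a \<in> P \<Longrightarrow>
     \<exists>r\<in>K. \<forall>Q. primeideal Q R \<and> P \<subseteq> Q \<longrightarrow> s \<ominus> r \<in> Q"
  shows "s \<in> residually_constant"
  using assms unfolding residually_constant_def by blast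

lemma residually_constantD:
  assumes "s \<in> residually_constant" "maximalideal P (R\<lparr>carrier := K\<rparr>)" "\<forall>a\<in>K. a \<in> P \<or> \<one> \<ominus> a \<in> P"
  obtains r where "r \<in> K" "\<forall>Q. primeideal Q R \<longrightarrow> P \<subseteq> Q \<longrightarrow> s \<ominus> r \<in> Q"
  using assms unfolding residually_constant_def by blast

lemma K_sub_residually_constant: "K \<subseteq> residually_constant"
proof
  fix s assume s: "s \<in> K"
  have "s \<ominus> s \<in> Q" if "primeideal Q R" for Q
    using ideal_closed(2)[of Q] that s K_closed(1) by (auto simp: primeideal_def a_minus_def r_neg)
  then show "s \<in> residually_constant" using s K_closed(1) by (intro residually_constantI) blast+
qed

text \<open>At a prime over P every residue comes from \<open>K\<close>, so with K/P of order two it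
  is 0 or 1. A unit cannot have residue 0, hence the constant is 1 at all these primes.\<close>

lemma Units_sub_residually_constant: "Units R \<subseteq> residually_constant"
proof
  fix u assume u: "u \<in> Units R"
  then have uc: "u \<in> carrier R" by auto
  show "u \<in> residually_constant"
  proof (rule residually_constantI[OF uc])
    fix P assume P: "maximalideal P (R\<lparr>carrier := K\<rparr>)" "\<forall>a\<in>K. a \<in> P \<or> \<one> \<ominus> a \<in> P"
    have "u \<ominus> \<one> \<in> Q" if Q: "primeideal Q R" "P \<subseteq> Q" for Q
    proof -
      have id: "ideal Q R" using Q(1) by (simp add: primeideal_def)
      note I = ideal_closed[OF id]
      have uQ: "u \<notin> Q" by (rule Units_notin_maximal[OF u id one_notin_proper(1)[OF Q(1)]])
      obtain a t where at: "a \<in> K" "t \<in> K - Q" "t \<otimes> u \<ominus> a \<in> Q" using residual[OF Q(1) uc] by auto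
      have c: "a \<in> carrier R" "t \<in> carrier R" "u \<in> carrier R" using at K_closed(1) uc by auto
      \<comment> \<open>The denominator t is outside \<open>Q\<close>, so outside \<open>P\<close>,
        and has residue 1 as well.\<close>
      have t: "\<one> \<ominus> t \<in> Q" using P(2) at(2) Q(2) by auto
      have "a \<notin> Q"
      proof
        assume "a \<in> Q"
        then have "(t \<otimes> u \<ominus> a) \<oplus> a \<in> Q" by (rule I(3)[OF at(3)])
        moreover have "(t \<otimes> u \<ominus> a) \<oplus> a = t \<otimes> u" using c by (simp add: ring_normal)
        ultimately have "t \<otimes> u \<in> Q" by simp
        then show False using primeideal.I_prime[OF Q(1) c(2,3)] uQ at(2) by auto
      qed
      then have "\<one> \<ominus> a \<in> Q" using P(2) at(1) Q(2) by auto
      moreover have "u \<ominus> \<one> = ((\<one> \<ominus> t) \<otimes> u \<oplus> (t \<otimes> u \<ominus> a)) \<ominus> (\<one> \<ominus> a)"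
        using c by (simp add: ring_normal)
      ultimately show ?thesis using I(5)[OF I(3)[OF I(7)[OF t c(3)] at(3)]] by simp
    qed
    then show "\<exists>r\<in>K. \<forall>Q. primeideal Q R \<and> P \<subseteq> Q \<longrightarrow> u \<ominus> r \<in> Q" using K_closed(3) by blast
  qed
qed

lemma subring_residually_constant: "subring residually_constant R"
proof (rule subringI)
  show Ec: "residually_constant \<subseteq> carrier R" by (auto simp: residually_constant_def)
  show "\<one> \<in> residually_constant" using K_sub_residually_constant K_closed(3) by auto
  show add: "s \<oplus> s' \<in> residually_constant" if s: "s \<in> residually_constant" "s' \<in> residually_constant" for s s'
  proof (rule residually_constantI)
    show "s \<oplus> s' \<in> carrier R" using s Ec by auto
    fix P assume P: "maximalideal P (R\<lparr>carrier := K\<rparr>)" "\<forall>a\<in>K. a \<in> P \<or> \<one> \<ominus> a \<in> P"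
    obtain r where r: "r \<in> K" "\<forall>Q. primeideal Q R \<longrightarrow> P \<subseteq> Q \<longrightarrow> s \<ominus> r \<in> Q" using residually_constantD[OF s(1) P] .
    obtain r' where r': "r' \<in> K" "\<forall>Q. primeideal Q R \<longrightarrow> P \<subseteq> Q \<longrightarrow> s' \<ominus> r' \<in> Q" using residually_constantD[OF s(2) P] .
    have c: "s \<in> carrier R" "s' \<in> carrier R" "r \<in> carrier R" "r' \<in> carrier R"
      using s Ec r(1) r'(1) K_closed(1) by auto
    have "(s \<oplus> s') \<ominus> (r \<oplus> r') = (s \<ominus> r) \<oplus> (s' \<ominus> r')" using c by (simp add: ring_normal)
    then have "(s \<oplus> s') \<ominus> (r \<oplus> r') \<in> Q" if "primeideal Q R" "P \<subseteq> Q" for Q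
      using ideal_closed(3)[OF _ r(2)[rule_format, OF that] r'(2)[rule_format, OF that]] that(1) by (simp add: primeideal_def)
    then show "\<exists>r\<in>K. \<forall>Q. primeideal Q R \<and> P \<subseteq> Q \<longrightarrow> (s \<oplus> s') \<ominus> r \<in> Q"
      using K_closed(5)[OF r(1) r'(1)] by blast
  qed
  show mult: "s \<otimes> s' \<in> residually_constant" if s: "s \<in> residually_constant" "s' \<in> residually_constant" for s s'
  proof (rule residually_constantI)
    show "s \<otimes> s' \<in> carrier R" using s Ec by auto
    fix P assume P: "maximalideal P (R\<lparr>carrier := K\<rparr>)" "\<forall>a\<in>K. a \<in> P \<or> \<one> \<ominus> a \<in> P"
    obtain r where r: "r \<in> K" "\<forall>Q. primeideal Q R \<longrightarrow> P \<subseteq> Q \<longrightarrow> s \<ominus> r \<in> Q" using residually_constantD[OF s(1) P] .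
    obtain r' where r': "r' \<in> K" "\<forall>Q. primeideal Q R \<longrightarrow> P \<subseteq> Q \<longrightarrow> s' \<ominus> r' \<in> Q" using residually_constantD[OF s(2) P] .
    have c: "s \<in> carrier R" "s' \<in> carrier R" "r \<in> carrier R" "r' \<in> carrier R"
      using s Ec r(1) r'(1) K_closed(1) by auto
    have eq: "(s \<otimes> s') \<ominus> (r \<otimes> r') = (s \<ominus> r) \<otimes> s' \<oplus> r \<otimes> (s' \<ominus> r')"
      using c by (simp add: ring_normal)
    have "(s \<otimes> s') \<ominus> (r \<otimes> r') \<in> Q" if Q: "primeideal Q R" "P \<subseteq> Q" for Q
    proof -
      have "ideal Q R" using Q(1) by (simp add: primeideal_def)
      note I = ideal_closed[OF this]
      show ?thesis unfolding eq by (rule I(3)[OF I(7)[OF r(2)[rule_format, OF Q] c(2)] I(6)[OF r'(2)[rule_format, OF Q] c(3)]])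
    qed
    then show "\<exists>r\<in>K. \<forall>Q. primeideal Q R \<and> P \<subseteq> Q \<longrightarrow> (s \<otimes> s') \<ominus> r \<in> Q"
      using K_closed(7)[OF r(1) r'(1)] by blast
  qed
  show "\<ominus> s \<in> residually_constant" if s: "s \<in> residually_constant" for s
  proof -
    have "\<ominus> \<one> \<in> residually_constant" using K_sub_residually_constant K_closed(3,4) by auto
    then have "\<ominus> \<one> \<otimes> s \<in> residually_constant" using mult s by blast
    then show ?thesis using s Ec by (auto simp: l_minus)
  qed
qed

text \<open>Let m be least such that all x^j with j >= m lie in \<open>K\<close>. If m >= 2, then y
  = x^(m-1) has its square and cube in \<open>K\<close> because 2 (m - 1) >= m; seminormality puts y
  in \<open>K\<close> and contradicts the choice of m.\<close>

lemma nilpotent_residue_in_K: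
  assumes "x \<in> carrier R" and "\<And>j. j \<ge> k \<Longrightarrow> x [^] (j::nat) \<in> K"
  shows "x \<in> K"
proof (rule ccontr)
  assume neg: "x \<notin> K"
  define m where "m = (LEAST k. \<forall>j\<ge>k. x [^] (j::nat) \<in> K)"
  have m: "\<forall>j\<ge>m. x [^] j \<in> K"
    unfolding m_def by (rule LeastI[of _ k]) (use assms(2) in auto)
  have "m \<ge> 2"
  proof (rule ccontr)
    assume "\<not> m \<ge> 2"
    then have "x [^] (1::nat) \<in> K" using m by (metis One_nat_def less_2_cases_iff not_le order_refl zero_le)
    then show False using neg assms(1) by simp
  qed
  define y where "y = x [^] (m - 1)"
  have "\<not> (\<forall>j\<ge>m - 1. x [^] j \<in> K)"
    using not_less_Least[of "m - 1" "\<lambda>k. \<forall>j\<ge>k. x [^] (j::nat) \<in> K"] \<open>m \<ge> 2\<close> by (auto simp: m_def)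
  then obtain j where j: "j \<ge> m - 1" "x [^] j \<notin> K" by auto
  then have "j = m - 1" using m by (metis Suc_diff_1 \<open>2 \<le> m\<close> le_antisym not_less_eq_eq order_less_le_trans pos2)
  then have "y \<notin> K" using j by (simp add: y_def)
  moreover have "y [^] (2::nat) \<in> K" "y [^] (3::nat) \<in> K"
    unfolding y_def nat_pow_pow[OF assms(1)] by (rule m[rule_format], use \<open>m \<ge> 2\<close> in simp)+
  moreover have "y \<in> carrier R" using assms(1) by (simp add: y_def)
  ultimately show False using seminormal_K unfolding seminormal_def by blast
qed

lemma power_in_horner:
  assumes b: "b \<in> carrier R"
  obtains n where "b [^] Suc n \<in> horner R K b n"
proof -
  interpret h: horner_module R K K b
    by (intro horner_module.intro horner_module_axioms.intro cring_axioms subring_K b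
        K_closed(1,2,5,7))
  have ev: "eval l b \<in> horner R K b (length l - 1)" if "set l \<subseteq> K" "l \<noteq> []" for l
    using that
  proof (induction l)
    case (Cons a l)
    have a: "a \<in> K" "a \<in> carrier R" using Cons.prems K_closed(1) by auto
    show ?case
    proof (cases "l = []")
      case True
      then show ?thesis using a b by simp
    next
      case False
      then have "eval l b \<in> horner R K b (length l - 1)" using Cons by auto
      then have "eval l b \<in> horner R K b (length l)"
        using h.horner_le[of "length l - 1" "length l"] by auto
      then show ?thesis using h.horner_add[OF h.horner_top[OF a(1)]] by simp
    qed
  qed simp
  obtain l where l: "set l \<subseteq> K" "eval (\<one> # l) b = \<zero>" using integral_K[OF b] by auto
  \<comment> \<open>With an empty list the equation would read 1 = 0. So the degree
    \<open>length l\<close> is a successor, and n is its predecessor.\<close>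
  have ne: "l \<noteq> []" using l(2) one_not_zero by auto
  have v: "eval l b \<in> carrier R" using eval_in_carrier[of l b] l(1) K_closed(1) b by auto
  have "b [^] length l = (\<ominus> \<one>) \<otimes> eval l b"
    using l(2) b v minus_equality[of "b [^] length l" "eval l b"] by (simp add: l_minus)
  also have "\<dots> \<in> horner R K b (length l - 1)"
    using h.horner_scale[OF _ ev[OF l(1) ne]] K_closed(3,4) by auto
  finally show thesis using that[of "length l - 1"] ne by simp
qed

lemma exists_maximal_over_conductor:
  assumes b: "b \<in> carrier R" "b \<notin> K"
  obtains P where "maximalideal P (R\<lparr>carrier := K\<rparr>)" "\<forall>t\<in>K - P. t \<otimes> b \<notin> K"
proof -
  interpret K: cring "R\<lparr>carrier := K\<rparr>"
    using subcring_iff[OF K_closed(1)] subcringI'[OF subring_K] by simp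
  let ?I = "{t \<in> K. t \<otimes> b \<in> K}"
  have c: "t \<in> carrier R" if "t \<in> K" for t using that K_closed(1) by auto
  have "ideal ?I (R\<lparr>carrier := K\<rparr>)"
  proof (rule K.cring_idealI)
    show "?I \<subseteq> carrier (R\<lparr>carrier := K\<rparr>)" by auto
    show "\<zero>\<^bsub>R\<lparr>carrier := K\<rparr>\<^esub> \<in> ?I" using K_closed(2) b(1) by simp
    fix s t assume "s \<in> ?I" "t \<in> ?I"
    then show "s \<oplus>\<^bsub>R\<lparr>carrier := K\<rparr>\<^esub> t \<in> ?I" using K_closed(5) c b(1) by (simp add: l_distr)
  next
    fix t r assume "t \<in> ?I" "r \<in> carrier (R\<lparr>carrier := K\<rparr>)"
    then show "r \<otimes>\<^bsub>R\<lparr>carrier := K\<rparr>\<^esub> t \<in> ?I" using K_closed(7) c b(1) by (simp add: m_assoc)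
  qed
  moreover have "\<one>\<^bsub>R\<lparr>carrier := K\<rparr>\<^esub> \<notin> ?I" using b by simp
  ultimately obtain P where "maximalideal P (R\<lparr>carrier := K\<rparr>)" "?I \<subseteq> P"
    by (rule K.exists_maximal)
  moreover then have "\<forall>t\<in>K - P. t \<otimes> b \<notin> K" by blast
  ultimately show thesis using that by simp
qed

text \<open>By \<open>top\<close> all higher powers of b reduce to degree at most n, so these
  polynomials are already the whole ring K[b].\<close>

lemma subring_horner:
  assumes b: "b \<in> carrier R" and top: "b [^] Suc n \<in> horner R K b n"
  shows "subring (horner R K b n) R"
proof -
  interpret h: horner_module R K K b
    by (intro horner_module.intro horner_module_axioms.intro cring_axioms subring_K b
        K_closed(1,2,5,7))
  show ?thesis
  proof (rule subringI)
    show "horner R K b n \<subseteq> carrier R" by (rule h.horner_carrier)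
    show "\<one> \<in> horner R K b n" using h.coefficient_in_horner K_closed(3) by auto
    show "\<ominus> y \<in> horner R K b n" if y: "y \<in> horner R K b n" for y
    proof -
      have "y \<in> carrier R" using y h.horner_carrier by auto
      then have "\<ominus> \<one> \<otimes> y = \<ominus> y" by (simp add: l_minus)
      then show ?thesis using h.horner_scale[OF _ y, of "\<ominus> \<one>"] K_closed(3,4) by auto
    qed
  qed (auto intro: h.horner_mult[OF top] h.horner_add)
qed

text \<open>Nakayama's lemma for the module \<open>B/K\<close>, eliminating the generators \<open>b\<^sup>n, \<dots>, b\<close> one by one.\<close>

lemma nakayama_horner:
  assumes b: "b \<in> carrier R" and top: "b [^] Suc n \<in> horner R K b n"
    and P: "maximalideal P (R\<lparr>carrier := K\<rparr>)"
    and gen: "\<And>y. y \<in> horner R K b n \<Longrightarrow> \<exists>r\<in>K. \<exists>z\<in>horner R P b n. y = r \<oplus> z"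
    and k: "k \<le> n"
  shows "\<exists>t\<in>K - P. \<forall>y\<in>horner R K b n. t \<otimes> y \<in> horner R K b k"
  using k
\<comment> \<open>The degree bound k descends from n, where t = 1 works; every step enlarges the
  multiplier t.\<close>
proof (induction "n - k" arbitrary: k)
  note PK = subring_maximalideal[OF subring_K P]
  case 0
  then have "k = n" by simp
  moreover have "\<one> \<otimes> y = y" if "y \<in> horner R K b n" for y
    using that subringE(1)[OF subring_horner[OF b top]] by auto
  ultimately show ?case using PK(2) K_closed(3) by (intro bexI[of _ \<one>]) auto
next
  note PK = subring_maximalideal[OF subring_K P]
  note cl = subring_ideal_closed[OF subring_K PK(1)]
  interpret h: horner_module R K K b
    by (intro horner_module.intro horner_module_axioms.intro cring_axioms subring_K b
        K_closed(1,2,5,7))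
  have Pc: "P \<subseteq> carrier R" using cl(1) K_closed(1) by auto
  interpret p: horner_module R K P b
    by (intro horner_module.intro horner_module_axioms.intro cring_axioms subring_K b
        Pc cl(2,3,5))
  note Bs = subringE[OF subring_horner[OF b top]]
  case (Suc j)
  let ?k = "Suc k"
  have "?k \<le> n" "j = n - ?k" using Suc.hyps(2) by auto
  then obtain t where t: "t \<in> K - P" "\<And>y. y \<in> horner R K b n \<Longrightarrow> t \<otimes> y \<in> horner R K b ?k"
    using Suc.hyps(1)[of ?k] by blast
  have tc: "t \<in> carrier R" "t \<in> K" using t(1) K_closed(1) by auto
  have bB: "b [^] i \<in> horner R K b n" for i :: nat
  proof (induction i)
    case 0
    then show ?case using Bs(3) by simp
  next
    case (Suc i)
    have "b [^] Suc i = b \<otimes> b [^] i" using b by (simp add: m_comm)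
    then show ?case using h.horner_stable[OF top Suc] by simp
  qed
  \<comment> \<open>Multiplication by t brings every power of b down to degree at most k + 1, so P B
    is sent to polynomials of that degree with coefficients in \<open>P\<close>.\<close>
  have small: "t \<otimes> z \<in> horner R P b ?k" if "z \<in> horner R P b i" for z i
    using that
  proof (induction i arbitrary: z)
    case 0
    then have z: "z \<in> P" "z \<in> carrier R" using Pc by auto
    have "t \<otimes> z \<in> P" using cl(5)[OF z(1) tc(2)] .
    then show ?case using p.coefficient_in_horner by (rule rev_subsetD)
  next
    case (Suc i)
    obtain z' x where z: "z' \<in> horner R P b i" "x \<in> P" "z = z' \<oplus> x \<otimes> b [^] Suc i"
      using p.horner_split[OF Suc.prems] by auto
    define B where "B = b [^] Suc i"
    have c: "z' \<in> carrier R" "x \<in> carrier R" "B \<in> carrier R" "t \<in> carrier R"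
      using z p.horner_carrier Pc b tc by (auto simp: B_def)
    have "t \<otimes> z = t \<otimes> z' \<oplus> x \<otimes> (t \<otimes> B)"
      unfolding z(3) B_def[symmetric] using c by (simp add: ring_normal)
    moreover have "x \<otimes> (t \<otimes> B) \<in> horner R P b ?k"
      using p.coefficient_times_horner[OF z(2) t(2)[OF bB]] unfolding B_def .
    ultimately show ?case using p.horner_add[OF Suc.IH[OF z(1)]] by simp
  qed
  define B where "B = b [^] ?k"
  have Bc: "B \<in> carrier R" using b by (simp add: B_def)
  \<comment> \<open>By \<open>gen\<close>, b^(k+1) = r + z with z in P B, and t z = z' + x b^(k+1)
    with x in \<open>P\<close> and z' of degree at most k. Hence (t - x) b^(k+1) = t r + z' has
    degree at most k, while t - x stays outside \<open>P\<close>.\<close>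
  obtain r z where rz: "r \<in> K" "z \<in> horner R P b n" "B = r \<oplus> z"
    using gen[OF bB] unfolding B_def by blast
  obtain z' x where z: "z' \<in> horner R P b k" "x \<in> P" "t \<otimes> z = z' \<oplus> x \<otimes> B"
    using p.horner_split[OF small[OF rz(2)]] unfolding B_def by auto
  have c: "r \<in> carrier R" "z \<in> carrier R" "z' \<in> carrier R" "x \<in> carrier R" "x \<in> K"
    using rz z p.horner_carrier Pc K_closed(1) cl(1) by auto
  have "(t \<ominus> x) \<otimes> B = (t \<otimes> r \<oplus> t \<otimes> z) \<ominus> x \<otimes> B"
  proof -
    have "t \<otimes> B = t \<otimes> r \<oplus> t \<otimes> z" using rz(3) c tc by (simp add: r_distr)
    moreover have "(t \<ominus> x) \<otimes> B = t \<otimes> B \<ominus> x \<otimes> B" using c tc Bc by (simp add: ring_normal)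
    ultimately show ?thesis by simp
  qed
  also have "\<dots> = t \<otimes> r \<oplus> z'"
    unfolding z(3) using c tc Bc by (simp add: ring_normal)
  also have "\<dots> \<in> horner R K b k"
    using h.horner_add[of "t \<otimes> r" k z'] h.coefficient_in_horner[of k] K_closed(7)[OF tc(2) rz(1)]
      horner_mono[OF cl(1), of R b k] z(1) by blast
  finally have top': "(t \<ominus> x) \<otimes> B \<in> horner R K b k" .
  have tx: "t \<ominus> x \<in> K" "t \<ominus> x \<notin> P"
  proof -
    show "t \<ominus> x \<in> K" using K_closed(6) tc c by auto
    have "(t \<ominus> x) \<oplus> x = t" using c tc by (simp add: ring_normal)
    then show "t \<ominus> x \<notin> P" using cl(3)[OF _ z(2), of "t \<ominus> x"] t(1) by auto
  qed
  \<comment> \<open>The factor t lowers the degree to k + 1; the factor t - x then removes the top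
    power.\<close>
  have "(t \<ominus> x) \<otimes> t \<in> K - P" using K_closed(7)[OF tx(1) tc(2)] PK(3)[OF tx(1) tc(2)] tx t(1) by auto
  moreover have "(t \<ominus> x) \<otimes> t \<otimes> y \<in> horner R K b k" if y: "y \<in> horner R K b n" for y
  proof -
    obtain y' v where yv: "y' \<in> horner R K b k" "v \<in> K" "t \<otimes> y = y' \<oplus> v \<otimes> B"
      using h.horner_split[OF t(2)[OF y]] unfolding B_def by auto
    have cc: "y \<in> carrier R" "y' \<in> carrier R" "v \<in> carrier R" using y yv Bs(1) h.horner_carrier K_closed(1) by auto
    have "(t \<ominus> x) \<otimes> t \<otimes> y = (t \<ominus> x) \<otimes> (t \<otimes> y)"
      using m_assoc tc c cc by simp
    also have "\<dots> = (t \<ominus> x) \<otimes> y' \<oplus> v \<otimes> ((t \<ominus> x) \<otimes> B)"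
      unfolding yv(3) using c cc tc Bc by (simp add: ring_normal)
    also have "\<dots> \<in> horner R K b k"
      by (rule h.horner_add[OF h.horner_scale[OF tx(1) yv(1)] h.horner_scale[OF yv(2) top']])
    finally show ?thesis .
  qed
  ultimately show ?case by blast
qed

theorem Units_sub_K: "Units R \<subseteq> K"
proof (rule ccontr)
  assume neg: "\<not> Units R \<subseteq> K"
  define A where "A = {T \<in> intermediate_rings K R. T \<subseteq> residually_constant \<and> T \<noteq> K}"
  have "finite A" using FIP_K unfolding FIP_def A_def by simp
  moreover have "residually_constant \<in> A"
    using neg Units_sub_residually_constant K_sub_residually_constant subcringI'[OF subring_residually_constant] by (auto simp: A_def intermediate_rings_def)
  ultimately obtain B where BA: "B \<in> A" and min: "\<And>T. T \<in> A \<Longrightarrow> T \<subseteq> B \<Longrightarrow> T = B"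
    using finite_has_minimal[of A] by (metis empty_iff)
  have B: "subring B R" "K \<subseteq> B" "B \<subseteq> residually_constant" "B \<noteq> K"
    using BA subcring.axioms(1) by (auto simp: A_def intermediate_rings_def)
  have minimal: "T = K \<or> T = B" if "subring T R" "K \<subseteq> T" "T \<subseteq> B" for T
    using min[of T] that subcringI'[OF that(1)] B(3) by (auto simp: A_def intermediate_rings_def)
  note Bs = subringE[OF B(1)]
  obtain b where b: "b \<in> B" "b \<notin> K" using B(2,4) by auto
  have bc: "b \<in> carrier R" using b Bs(1) by auto
  obtain n where top: "b [^] Suc n \<in> horner R K b n" by (rule power_in_horner[OF bc])
  obtain P where P: "maximalideal P (R\<lparr>carrier := K\<rparr>)" "\<forall>t\<in>K - P. t \<otimes> b \<notin> K"
    by (rule exists_maximal_over_conductor[OF bc b(2)])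
  note PK = subring_maximalideal[OF subring_K P(1)]
  note cl = subring_ideal_closed[OF subring_K PK(1)]
  \<comment> \<open>The element b itself is the single witness that \<open>residue_two\<close> asks
    for.\<close>
  have binary: "\<forall>a\<in>K. a \<in> P \<or> \<one> \<ominus> a \<in> P" using residue_two[OF P(1) bc] P(2) by blast
  interpret h: horner_module R K K b
    by (intro horner_module.intro horner_module_axioms.intro cring_axioms subring_K bc
        K_closed(1,2,5,7))
  have Pc: "P \<subseteq> carrier R" using cl(1) K_closed(1) by auto
  interpret p: horner_module R K P b
    by (intro horner_module.intro horner_module_axioms.intro cring_axioms subring_K bc
        Pc cl(2,3,5))
  have horner_B: "horner R K b k \<subseteq> B" for k
  proof (induction k)
    case (Suc k)
    have "x \<oplus> b \<otimes> y \<in> B" if "x \<in> K" "y \<in> horner R K b k" for x y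
      by (rule Bs(7)[OF _ Bs(6)[OF b(1)]]) (use that Suc B(2) in auto)
    then show ?case by auto
  qed (simp add: B(2))
  have "b = b \<otimes> \<one>" using bc by simp
  then have "b \<in> horner R K b n"
    using h.horner_stable[OF top, of \<one>] h.coefficient_in_horner[of n] K_closed(3) by auto
  then have B_eq: "B = horner R K b n"
    using minimal[OF subring_horner[OF bc top] h.coefficient_in_horner horner_B] b(2) by auto
  \<comment> \<open>This is the ideal P B, written through the description of \<open>B\<close> as
    K[b].\<close>
  define N where "N = horner R P b n"
  have N: "N \<subseteq> B" "\<zero> \<in> N" "P \<subseteq> N" "\<And>y z. y \<in> N \<Longrightarrow> z \<in> N \<Longrightarrow> y \<oplus> z \<in> N"
    "\<And>y z. y \<in> N \<Longrightarrow> z \<in> B \<Longrightarrow> z \<otimes> y \<in> N"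
    unfolding N_def B_eq using horner_mono[OF cl(1)] p.horner_zero p.horner_add
      p.horner_mult[OF top] p.coefficient_in_horner by auto
  have Nc: "z \<in> carrier R" if "z \<in> N" for z using that N(1) Bs(1) by auto
  let ?T = "{r \<oplus> z | r z. r \<in> K \<and> z \<in> N}"
  have memT: "r \<oplus> z \<in> ?T" if "r \<in> K" "z \<in> N" for r z using that by blast
  have K_T: "K \<subseteq> ?T"
  proof
    fix r assume "r \<in> K"
    moreover then have "r \<oplus> \<zero> = r" using K_closed(1) by auto
    ultimately show "r \<in> ?T" using memT[OF _ N(2), of r] by metis
  qed
  have N_T: "N \<subseteq> ?T"
  proof
    fix z assume "z \<in> N"
    moreover then have "\<zero> \<oplus> z = z" using Nc by auto
    ultimately show "z \<in> ?T" using memT[OF K_closed(2), of z] by metis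
  qed
  have "subring ?T R"
  proof (rule subringI)
    show "?T \<subseteq> carrier R" using K_closed(1) Nc by auto
    show "\<one> \<in> ?T" using K_T K_closed(3) by auto
    fix v assume "v \<in> ?T"
    then obtain r z where v: "v = r \<oplus> z" "r \<in> K" "z \<in> N" by auto
    have c: "r \<in> carrier R" "z \<in> carrier R" "r \<in> B" using v K_closed(1) Nc B(2) by auto
    have "\<ominus> v = \<ominus> r \<oplus> (\<ominus> \<one>) \<otimes> z" unfolding v using c by (simp add: ring_normal)
    then show "\<ominus> v \<in> ?T" using memT[OF K_closed(4)[OF v(2)] N(5)[OF v(3)]] Bs(3,5) by simp
    fix w assume "w \<in> ?T"
    then obtain r' z' where w: "w = r' \<oplus> z'" "r' \<in> K" "z' \<in> N" by auto
    have c': "r' \<in> carrier R" "z' \<in> carrier R" "r' \<in> B" "z' \<in> B"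
      using w K_closed(1) Nc B(2) N(1) by auto
    have "v \<otimes> w = r \<otimes> r' \<oplus> (r \<otimes> z' \<oplus> (r' \<otimes> z \<oplus> z' \<otimes> z))"
      unfolding v w using c c' by (simp add: ring_normal)
    moreover have "r \<otimes> z' \<oplus> (r' \<otimes> z \<oplus> z' \<otimes> z) \<in> N"
      by (intro N(4,5) v w c c')
    ultimately show "v \<otimes> w \<in> ?T" using memT[OF K_closed(7)[OF v(2) w(2)]] by simp
    have "v \<oplus> w = (r \<oplus> r') \<oplus> (z \<oplus> z')"
      unfolding v w using c c' by (simp add: ring_normal)
    then show "v \<oplus> w \<in> ?T" using memT[OF K_closed(5)[OF v(2) w(2)] N(4)[OF v(3) w(3)]] by simp
  qed
  moreover have "?T \<subseteq> B" using B(2) N(1) Bs(7) by blast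
  ultimately consider "?T = B" | "?T = K" using minimal K_T by blast
  then show False
  proof cases
    case 1
    have "\<exists>r\<in>K. \<exists>z\<in>horner R P b n. y = r \<oplus> z" if "y \<in> horner R K b n" for y
      using that 1 unfolding B_eq N_def by blast
    \<comment> \<open>At degree bound 0 only constants from \<open>K\<close> remain, so t b lies in
      \<open>K\<close> for some t outside \<open>P\<close>.\<close>
    then obtain t where "t \<in> K - P" "\<forall>y\<in>horner R K b n. t \<otimes> y \<in> horner R K b 0"
      using nakayama_horner[OF bc top P(1) _ le0] by blast
    then show False using P(2) b(1) unfolding B_eq by auto
  next
    case 2
    then have NK: "N \<subseteq> K" using N_T by simp
    have "b \<in> residually_constant" using b(1) B(3) by auto
    then obtain r where r: "r \<in> K" "\<forall>Q. primeideal Q R \<longrightarrow> P \<subseteq> Q \<longrightarrow> b \<ominus> r \<in> Q"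
      by (rule residually_constantD[OF _ P(1) binary])
    define x where "x = b \<ominus> r"
    have rc: "r \<in> carrier R" "r \<in> B" using r(1) K_closed(1) B(2) by auto
    have x: "x \<in> B" using b(1) rc(2) Bs(5,7) by (simp add: x_def a_minus_def)
    have xc: "x \<in> carrier R" using x Bs(1) by auto
    \<comment> \<open>Otherwise some prime of the big ring contains P B, hence \<open>P\<close>, but
      not x = b - r, against the choice of r.\<close>
    have "\<exists>k::nat. x [^] k \<in> N"
    proof (rule ccontr)
      assume "\<not> (\<exists>k::nat. x [^] k \<in> N)"
      then have "\<exists>Q. primeideal Q R \<and> N \<subseteq> Q \<and> x \<notin> Q"
        using prime_over_avoiding[OF subring_K B(1,2) integral_K N(1,2,4,5) x] by metis
      then show False using r(2) N(3) unfolding x_def by blast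
    qed
    then obtain k :: nat where k: "x [^] k \<in> N" ..
    have xB: "x [^] i \<in> B" for i :: nat using x Bs(3,6) by (induction i) auto
    \<comment> \<open>One power in the ideal P B brings all later ones, and P B lies in
      \<open>K\<close> in this case.\<close>
    have "x [^] j \<in> K" if "j \<ge> k" for j :: nat
    proof -
      have "x [^] j = x [^] (j - k) \<otimes> x [^] k" using that xc by (simp add: nat_pow_mult)
      then show ?thesis using N(5)[OF k xB] NK by auto
    qed
    then have "x \<in> K" by (rule nilpotent_residue_in_K[OF xc])
    moreover have "b = x \<oplus> r" unfolding x_def using bc rc by (simp add: ring_normal)
    ultimately show False using K_closed(5) r(1) b(2) by simp
  qed
qed

end

section \<open>Residue fields\<close>

text \<open>Operations on fractions are defined as unions over representatives. Once the value is
  known not to depend on the representative, such a union collapses to it; the class must be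
  nonempty.\<close>

lemma UN_pair_const:
  assumes "(a, s) \<in> U" and "\<And>b t. (b, t) \<in> U \<Longrightarrow> f b t = c"
  shows "(\<Union>(b, t)\<in>U. f b t) = c"
proof -
  have "(\<Union>(b, t)\<in>U. f b t) = (\<Union>p\<in>U. c)" by (rule SUP_cong) (use assms(2) in auto)
  then show ?thesis using assms(1) by auto
qed

section \<open>Localization at a prime ideal and its residue field\<close>

locale prime_localization = cring R for R (structure) +
  fixes P T
  assumes prime_P: "primeideal P R"
  defines "T \<equiv> carrier R - P"
begin

lemma ideal_P: "ideal P R"
  using prime_P by (simp add: primeideal_def)

lemma T_closed: "\<one> \<in> T" "s \<in> T \<Longrightarrow> s \<in> carrier R" "s \<in> T \<Longrightarrow> t \<in> T \<Longrightarrow> s \<otimes> t \<in> T"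
  using one_notin_proper(1)[OF prime_P] primeideal.I_prime[OF prime_P] by (auto simp: T_def)

lemma T_notin: "s \<in> T \<Longrightarrow> s \<notin> P"
  by (simp add: T_def)

lemma equiv_frac_rel: "equiv (carrier R \<times> T) (frac_rel R T)"
proof (rule equivI)
  show "frac_rel R T \<subseteq> (carrier R \<times> T) \<times> carrier R \<times> T" by (auto simp: frac_rel_def)
  show "refl_on (carrier R \<times> T) (frac_rel R T)"
    using T_closed(1) by (auto simp: refl_on_def frac_rel_def)
  show "sym (frac_rel R T)"
    by (auto simp: sym_def frac_rel_def) metis
  show "trans (frac_rel R T)"
  proof (rule transI)
    fix p q r assume pq: "(p, q) \<in> frac_rel R T" and qr: "(q, r) \<in> frac_rel R T"
    obtain a s b t where p: "p = (a, s)" and q: "q = (b, t)" by (cases p, cases q)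
    obtain c w where r: "r = (c, w)" by (cases r)
    obtain u where u: "u \<in> T" "u \<otimes> (t \<otimes> a) = u \<otimes> (s \<otimes> b)"
      using pq unfolding p q frac_rel_def by auto
    obtain v where v: "v \<in> T" "v \<otimes> (w \<otimes> b) = v \<otimes> (t \<otimes> c)"
      using qr unfolding r q frac_rel_def by auto
    have mem: "a \<in> carrier R" "b \<in> carrier R" "c \<in> carrier R" "s \<in> T" "t \<in> T" "w \<in> T"
      using pq qr unfolding p q r frac_rel_def by auto
    have cc: "a \<in> carrier R" "b \<in> carrier R" "c \<in> carrier R" "s \<in> carrier R" "t \<in> carrier R"
      "w \<in> carrier R" "u \<in> carrier R" "v \<in> carrier R" using mem u v T_closed(2) by auto
    \<comment> \<open>Besides the two multipliers, the denominator t of the middle fraction enters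
      the new one, because it cannot be cancelled.\<close>
    have "(u \<otimes> v \<otimes> t) \<otimes> (w \<otimes> a) = (v \<otimes> w) \<otimes> (u \<otimes> (t \<otimes> a))"
      using cc by (simp add: ring_normal)
    also have "\<dots> = (u \<otimes> s) \<otimes> (v \<otimes> (w \<otimes> b))"
      unfolding u(2) using cc by (simp add: ring_normal)
    also have "\<dots> = (u \<otimes> v \<otimes> t) \<otimes> (s \<otimes> c)"
      unfolding v(2) using cc by (simp add: ring_normal)
    finally show "(p, r) \<in> frac_rel R T"
      using mem T_closed(3)[OF T_closed(3)[OF u(1) v(1)] mem(5)] unfolding p r frac_rel_def by auto
  qed
qed

lemma frac_eq_iff:
  assumes "a \<in> carrier R" "s \<in> T" "b \<in> carrier R" "t \<in> T"
  shows "frac R T a s = frac R T b t \<longleftrightarrow> (\<exists>u\<in>T. u \<otimes> (t \<otimes> a) = u \<otimes> (s \<otimes> b))"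
  using eq_equiv_class_iff[OF equiv_frac_rel, of "(a, s)" "(b, t)"] assms
  by (simp add: frac_def frac_rel_def)

lemma frac_memD:
  assumes "(b, t) \<in> frac R T a s"
  shows "b \<in> carrier R" "t \<in> T" "frac R T b t = frac R T a s"
  using assms equiv_class_eq[OF equiv_frac_rel, of "(a, s)" "(b, t)"]
  by (auto simp: frac_def frac_rel_def)

lemma frac_self: "a \<in> carrier R \<Longrightarrow> s \<in> T \<Longrightarrow> (a, s) \<in> frac R T a s"
  using equiv_class_self[OF equiv_frac_rel, of "(a, s)"] by (simp add: frac_def)

lemma frac_eqI:
  assumes "a \<in> carrier R" "s \<in> T" "b \<in> carrier R" "t \<in> T" and "t \<otimes> a = s \<otimes> b"
  shows "frac R T a s = frac R T b t"
  using assms T_closed(1) by (auto simp: frac_eq_iff)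

abbreviation L where "L \<equiv> loc_ring R T"

lemma loc_carrier: "carrier L = {frac R T a s | a s. a \<in> carrier R \<and> s \<in> T}"
  unfolding loc_ring_def frac_def quotient_def by auto

lemma loc_carrierE:
  assumes "x \<in> carrier L"
  obtains a s where "a \<in> carrier R" "s \<in> T" "x = frac R T a s"
  using assms unfolding loc_carrier by blast

lemma loc_one: "\<one>\<^bsub>L\<^esub> = frac R T \<one> \<one>" and loc_zero: "\<zero>\<^bsub>L\<^esub> = frac R T \<zero> \<one>"
  by (simp_all add: loc_ring_def)

lemma loc_mult:
  assumes "a \<in> carrier R" "s \<in> T" "b \<in> carrier R" "t \<in> T"
  shows "frac R T a s \<otimes>\<^bsub>L\<^esub> frac R T b t = frac R T (a \<otimes> b) (s \<otimes> t)"
proof -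
  have wd: "frac R T (a' \<otimes> b') (s' \<otimes> t') = frac R T (a \<otimes> b) (s \<otimes> t)"
    if "(a', s') \<in> frac R T a s" "(b', t') \<in> frac R T b t" for a' s' b' t'
  proof -
    note m = frac_memD[OF that(1)] frac_memD[OF that(2)]
    obtain u where u: "u \<in> T" "u \<otimes> (s \<otimes> a') = u \<otimes> (s' \<otimes> a)"
      using m assms by (auto simp: frac_eq_iff)
    obtain v where v: "v \<in> T" "v \<otimes> (t \<otimes> b') = v \<otimes> (t' \<otimes> b)"
      using m assms by (auto simp: frac_eq_iff)
    have c: "a \<in> carrier R" "b \<in> carrier R" "a' \<in> carrier R" "b' \<in> carrier R" "s \<in> carrier R"
      "t \<in> carrier R" "s' \<in> carrier R" "t' \<in> carrier R" "u \<in> carrier R" "v \<in> carrier R"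
      using m assms u v T_closed(2) by auto
    have "(u \<otimes> v) \<otimes> ((s \<otimes> t) \<otimes> (a' \<otimes> b')) = (u \<otimes> (s \<otimes> a')) \<otimes> (v \<otimes> (t \<otimes> b'))"
      using c by (simp add: ring_normal)
    also have "\<dots> = (u \<otimes> v) \<otimes> ((s' \<otimes> t') \<otimes> (a \<otimes> b))"
      unfolding u(2) v(2) using c by (simp add: ring_normal)
    finally show ?thesis
      using m assms c T_closed(3) u(1) v(1) by (subst frac_eq_iff) auto
  qed
  have "frac R T a s \<otimes>\<^bsub>L\<^esub> frac R T b t =
      (\<Union>(a', s')\<in>frac R T a s. \<Union>(b', t')\<in>frac R T b t. frac R T (a' \<otimes> b') (s' \<otimes> t'))"
    by (simp add: loc_ring_def)
  also have "\<dots> = frac R T (a \<otimes> b) (s \<otimes> t)"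
    by (rule UN_pair_const[OF frac_self[OF assms(1,2)]],
        rule UN_pair_const[OF frac_self[OF assms(3,4)]], rule wd)
  finally show ?thesis .
qed

lemma loc_add:
  assumes "a \<in> carrier R" "s \<in> T" "b \<in> carrier R" "t \<in> T"
  shows "frac R T a s \<oplus>\<^bsub>L\<^esub> frac R T b t = frac R T ((t \<otimes> a) \<oplus> (s \<otimes> b)) (s \<otimes> t)"
proof -
  have wd: "frac R T ((t' \<otimes> a') \<oplus> (s' \<otimes> b')) (s' \<otimes> t') = frac R T ((t \<otimes> a) \<oplus> (s \<otimes> b)) (s \<otimes> t)"
    if "(a', s') \<in> frac R T a s" "(b', t') \<in> frac R T b t" for a' s' b' t'
  proof -
    note m = frac_memD[OF that(1)] frac_memD[OF that(2)]
    obtain u where u: "u \<in> T" "u \<otimes> (s \<otimes> a') = u \<otimes> (s' \<otimes> a)"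
      using m assms by (auto simp: frac_eq_iff)
    obtain v where v: "v \<in> T" "v \<otimes> (t \<otimes> b') = v \<otimes> (t' \<otimes> b)"
      using m assms by (auto simp: frac_eq_iff)
    have c: "a \<in> carrier R" "b \<in> carrier R" "a' \<in> carrier R" "b' \<in> carrier R" "s \<in> carrier R"
      "t \<in> carrier R" "s' \<in> carrier R" "t' \<in> carrier R" "u \<in> carrier R" "v \<in> carrier R"
      using m assms u v T_closed(2) by auto
    have "(u \<otimes> v) \<otimes> ((s \<otimes> t) \<otimes> ((t' \<otimes> a') \<oplus> (s' \<otimes> b')))
        = (v \<otimes> t \<otimes> t') \<otimes> (u \<otimes> (s \<otimes> a')) \<oplus> (u \<otimes> s \<otimes> s') \<otimes> (v \<otimes> (t \<otimes> b'))"
      using c by (simp add: ring_normal)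
    also have "\<dots> = (u \<otimes> v) \<otimes> ((s' \<otimes> t') \<otimes> ((t \<otimes> a) \<oplus> (s \<otimes> b)))"
      unfolding u(2) v(2) using c by (simp add: ring_normal)
    finally show ?thesis
      using m assms c T_closed(3) u(1) v(1) by (subst frac_eq_iff) auto
  qed
  have "frac R T a s \<oplus>\<^bsub>L\<^esub> frac R T b t =
      (\<Union>(a', s')\<in>frac R T a s. \<Union>(b', t')\<in>frac R T b t.
        frac R T ((t' \<otimes> a') \<oplus> (s' \<otimes> b')) (s' \<otimes> t'))"
    by (simp add: loc_ring_def)
  also have "\<dots> = frac R T ((t \<otimes> a) \<oplus> (s \<otimes> b)) (s \<otimes> t)"
    by (rule UN_pair_const[OF frac_self[OF assms(1,2)]],
        rule UN_pair_const[OF frac_self[OF assms(3,4)]], rule wd)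
  finally show ?thesis .
qed

lemma frac_closed: "a \<in> carrier R \<Longrightarrow> s \<in> T \<Longrightarrow> frac R T a s \<in> carrier L"
  unfolding loc_carrier by blast

lemma frac_zero: "s \<in> T \<Longrightarrow> frac R T \<zero> s = \<zero>\<^bsub>L\<^esub>"
  unfolding loc_zero by (rule frac_eqI) (simp_all add: T_closed)

lemma frac_l_neg:
  assumes "a \<in> carrier R" "s \<in> T"
  shows "frac R T (\<ominus> a) s \<oplus>\<^bsub>L\<^esub> frac R T a s = \<zero>\<^bsub>L\<^esub>"
proof -
  have c: "a \<in> carrier R" "s \<in> carrier R" using assms T_closed(2) by auto
  have "(s \<otimes> \<ominus> a) \<oplus> (s \<otimes> a) = \<zero>" using c by (simp add: ring_normal)
  then show ?thesis using loc_add[of "\<ominus> a" s a s] assms frac_zero T_closed(3) by simp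
qed

lemma cring_loc: "cring L"
proof (rule cringI)
  show "abelian_group L"
  proof (rule abelian_groupI)
    fix x y assume "x \<in> carrier L" "y \<in> carrier L"
    then obtain a s b t where *: "x = frac R T a s" "y = frac R T b t"
      and m: "a \<in> carrier R" "b \<in> carrier R" "s \<in> T" "t \<in> T" by (metis loc_carrierE)
    have c: "a \<in> carrier R" "b \<in> carrier R" "s \<in> carrier R" "t \<in> carrier R"
      using m T_closed(2) by auto
    show "x \<oplus>\<^bsub>L\<^esub> y \<in> carrier L"
      unfolding * using m c T_closed(3) by (simp add: loc_add frac_closed)
    show "x \<oplus>\<^bsub>L\<^esub> y = y \<oplus>\<^bsub>L\<^esub> x"
      unfolding * using m c by (simp add: loc_add a_comm m_comm)
    fix z assume "z \<in> carrier L"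
    then obtain d w where z: "z = frac R T d w" and m': "d \<in> carrier R" "w \<in> T"
      by (metis loc_carrierE)
    have c': "d \<in> carrier R" "w \<in> carrier R" using m' T_closed(2) by auto
    have "w \<otimes> (t \<otimes> a \<oplus> s \<otimes> b) \<oplus> s \<otimes> t \<otimes> d = t \<otimes> w \<otimes> a \<oplus> s \<otimes> (w \<otimes> b \<oplus> t \<otimes> d)"
      using c c' by (simp add: ring_normal)
    then show "x \<oplus>\<^bsub>L\<^esub> y \<oplus>\<^bsub>L\<^esub> z = x \<oplus>\<^bsub>L\<^esub> (y \<oplus>\<^bsub>L\<^esub> z)"
      unfolding * z using m m' c c' T_closed(3) by (simp add: loc_add m_assoc)
  next
    show "\<zero>\<^bsub>L\<^esub> \<in> carrier L" using T_closed(1) by (simp add: loc_zero frac_closed)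
    fix x assume "x \<in> carrier L"
    then obtain a s where x: "x = frac R T a s" and m: "a \<in> carrier R" "s \<in> T"
      by (metis loc_carrierE)
    have c: "a \<in> carrier R" "s \<in> carrier R" using m T_closed(2) by auto
    show "\<zero>\<^bsub>L\<^esub> \<oplus>\<^bsub>L\<^esub> x = x"
      unfolding x loc_zero using m c T_closed(1) by (simp add: loc_add)
    have "frac R T (\<ominus> a) s \<oplus>\<^bsub>L\<^esub> x = \<zero>\<^bsub>L\<^esub>" unfolding x by (rule frac_l_neg[OF m])
    then show "\<exists>y\<in>carrier L. y \<oplus>\<^bsub>L\<^esub> x = \<zero>\<^bsub>L\<^esub>" using frac_closed[OF a_inv_closed[OF m(1)] m(2)] by blast
  qed
  show "comm_monoid L"
  proof (rule comm_monoidI)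
    show "\<one>\<^bsub>L\<^esub> \<in> carrier L" using T_closed(1) by (simp add: loc_one frac_closed)
    fix x y assume "x \<in> carrier L" "y \<in> carrier L"
    then obtain a s b t where *: "x = frac R T a s" "y = frac R T b t"
      and m: "a \<in> carrier R" "b \<in> carrier R" "s \<in> T" "t \<in> T" by (metis loc_carrierE)
    have c: "a \<in> carrier R" "b \<in> carrier R" "s \<in> carrier R" "t \<in> carrier R"
      using m T_closed(2) by auto
    show "x \<otimes>\<^bsub>L\<^esub> y \<in> carrier L"
      unfolding * using m c T_closed(3) by (simp add: loc_mult frac_closed)
    show "x \<otimes>\<^bsub>L\<^esub> y = y \<otimes>\<^bsub>L\<^esub> x"
      unfolding * using m c by (simp add: loc_mult m_comm)
    show "\<one>\<^bsub>L\<^esub> \<otimes>\<^bsub>L\<^esub> x = x"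
      unfolding * loc_one using m c T_closed(1) by (simp add: loc_mult)
    fix z assume "z \<in> carrier L"
    then obtain d w where z: "z = frac R T d w" and m': "d \<in> carrier R" "w \<in> T"
      by (metis loc_carrierE)
    have c': "d \<in> carrier R" "w \<in> carrier R" using m' T_closed(2) by auto
    show "x \<otimes>\<^bsub>L\<^esub> y \<otimes>\<^bsub>L\<^esub> z = x \<otimes>\<^bsub>L\<^esub> (y \<otimes>\<^bsub>L\<^esub> z)"
      unfolding * z using m m' c c' T_closed(3) by (simp add: loc_mult m_assoc)
  qed
  fix x y z assume "x \<in> carrier L" "y \<in> carrier L" "z \<in> carrier L"
  then obtain a s b t d w where *: "x = frac R T a s" "y = frac R T b t" "z = frac R T d w"
    and m: "a \<in> carrier R" "b \<in> carrier R" "d \<in> carrier R" "s \<in> T" "t \<in> T" "w \<in> T"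
    by (metis loc_carrierE)
  have c: "a \<in> carrier R" "b \<in> carrier R" "d \<in> carrier R" "s \<in> carrier R" "t \<in> carrier R"
    "w \<in> carrier R" using m T_closed(2) by auto
  \<comment> \<open>The two sides of distributivity come out with different denominators, (s t) w
    and (s w) (t w), so the fractions are compared by cross multiplication.\<close>
  have eq: "((s \<otimes> w) \<otimes> (t \<otimes> w)) \<otimes> ((t \<otimes> a \<oplus> s \<otimes> b) \<otimes> d)
      = ((s \<otimes> t) \<otimes> w) \<otimes> ((t \<otimes> w) \<otimes> (a \<otimes> d) \<oplus> (s \<otimes> w) \<otimes> (b \<otimes> d))"
    using c by (simp add: ring_normal)
  show "(x \<oplus>\<^bsub>L\<^esub> y) \<otimes>\<^bsub>L\<^esub> z = x \<otimes>\<^bsub>L\<^esub> z \<oplus>\<^bsub>L\<^esub> y \<otimes>\<^bsub>L\<^esub> z"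
    unfolding * using m c T_closed(3) frac_eqI[OF _ _ _ _ eq] by (simp add: loc_mult loc_add)
qed

lemma loc_minus:
  assumes "a \<in> carrier R" "s \<in> T" "b \<in> carrier R" "t \<in> T"
  shows "frac R T a s \<ominus>\<^bsub>L\<^esub> frac R T b t = frac R T ((t \<otimes> a) \<ominus> (s \<otimes> b)) (s \<otimes> t)"
proof -
  interpret L: cring L by (rule cring_loc)
  have c: "b \<in> carrier R" "t \<in> carrier R" "a \<in> carrier R" "s \<in> carrier R"
    using assms T_closed(2) by auto
  have "frac R T (\<ominus> b) t \<oplus>\<^bsub>L\<^esub> frac R T b t = \<zero>\<^bsub>L\<^esub>" by (rule frac_l_neg[OF assms(3,4)])
  then have "\<ominus>\<^bsub>L\<^esub> frac R T b t = frac R T (\<ominus> b) t"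
    by (rule L.minus_equality) (use assms frac_closed in auto)
  then show ?thesis
    using assms c by (simp add: a_minus_def loc_add r_minus)
qed

text \<open>Common denominators show that the fractions with numerator in \<open>P\<close> already
  form an ideal. It is the smallest one, since each of them is a generator a/1 times 1/s.\<close>

lemma loc_ideal_eq: "loc_ideal R P = {frac R T a s | a s. a \<in> P \<and> s \<in> T}" (is "_ = ?J")
proof -
  interpret L: cring L by (rule cring_loc)
  note I = ideal_closed[OF ideal_P]
  have mem: "frac R T a s \<in> ?J" if "a \<in> P" "s \<in> T" for a s using that by blast
  have J: "ideal ?J L"
  proof (rule L.cring_idealI)
    show "?J \<subseteq> carrier L" using I(1) frac_closed by auto
    show "\<zero>\<^bsub>L\<^esub> \<in> ?J" unfolding loc_zero by (rule mem) (use I(2) T_closed(1) in auto)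
    fix x y assume "x \<in> ?J" "y \<in> ?J"
    then obtain a s b t where *: "x = frac R T a s" "y = frac R T b t"
      and m: "a \<in> P" "s \<in> T" "b \<in> P" "t \<in> T" by auto
    have "x \<oplus>\<^bsub>L\<^esub> y = frac R T ((t \<otimes> a) \<oplus> (s \<otimes> b)) (s \<otimes> t)"
      unfolding * using m I(1) by (intro loc_add) auto
    also have "\<dots> \<in> ?J" by (rule mem) (use m I(3,6) T_closed(2,3) in auto)
    finally show "x \<oplus>\<^bsub>L\<^esub> y \<in> ?J" .
  next
    fix x y assume "x \<in> ?J" and y: "y \<in> carrier L"
    then obtain a s where x: "x = frac R T a s" "a \<in> P" "s \<in> T" by auto
    obtain b t where "b \<in> carrier R" "t \<in> T" "y = frac R T b t" using y by (rule loc_carrierE)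
    note * = x(1) this(3) and m = x(2,3) this(1,2)
    have "y \<otimes>\<^bsub>L\<^esub> x = frac R T (b \<otimes> a) (t \<otimes> s)"
      unfolding * using m I(1) by (intro loc_mult) auto
    also have "\<dots> \<in> ?J" by (rule mem) (use m I(6) T_closed(3) in auto)
    finally show "y \<otimes>\<^bsub>L\<^esub> x \<in> ?J" .
  qed
  have gens: "(\<lambda>a. frac R T a \<one>) ` P \<subseteq> ?J" using T_closed(1) by auto
  show ?thesis
  proof
    show "loc_ideal R P \<subseteq> ?J"
      unfolding loc_ideal_def T_def[symmetric] by (rule L.genideal_minimal[OF J gens])
    show "?J \<subseteq> loc_ideal R P"
    proof
      fix x assume "x \<in> ?J"
      then obtain a s where x: "x = frac R T a s" "a \<in> P" "s \<in> T" by auto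
      have sub: "(\<lambda>a. frac R T a \<one>) ` P \<subseteq> carrier L" using I(1) T_closed(1) frac_closed by auto
      have "frac R T a \<one> \<in> loc_ideal R P"
        unfolding loc_ideal_def T_def[symmetric] using L.genideal_self[OF sub] x(2) by auto
      moreover have "ideal (loc_ideal R P) L"
        unfolding loc_ideal_def T_def[symmetric] by (rule L.genideal_ideal[OF sub])
      moreover have "x = frac R T a \<one> \<otimes>\<^bsub>L\<^esub> frac R T \<one> s"
        using x I(1) T_closed by (auto simp: loc_mult)
      ultimately show "x \<in> loc_ideal R P"
        using L.ideal_closed(7) frac_closed T_closed x(3) by auto
    qed
  qed
qed

lemma ideal_loc_ideal: "ideal (loc_ideal R P) L"
proof -
  interpret L: cring L by (rule cring_loc)
  have "(\<lambda>a. frac R T a \<one>) ` P \<subseteq> carrier L"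
    using ideal_closed(1)[OF ideal_P] T_closed(1) frac_closed by auto
  then show ?thesis unfolding loc_ideal_def T_def[symmetric] by (rule L.genideal_ideal)
qed

text \<open>If a/s = b/t with b in \<open>P\<close>, then u t a lies in \<open>P\<close> for some u
  outside \<open>P\<close>, and primality strips off u and t. Membership is thus visible on any
  representative.\<close>

lemma frac_in_loc_ideal_iff:
  assumes "a \<in> carrier R" "s \<in> T"
  shows "frac R T a s \<in> loc_ideal R P \<longleftrightarrow> a \<in> P"
proof
  note I = ideal_closed[OF ideal_P]
  assume "frac R T a s \<in> loc_ideal R P"
  then obtain b t where bt: "frac R T a s = frac R T b t" "b \<in> P" "t \<in> T"
    unfolding loc_ideal_eq by auto
  then obtain u where u: "u \<in> T" "u \<otimes> (t \<otimes> a) = u \<otimes> (s \<otimes> b)"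
    using frac_eq_iff[of a s b t] assms I(1) by auto
  have "u \<otimes> (s \<otimes> b) \<in> P" using I(6) bt(2) assms(2) u(1) T_closed(2) by auto
  then have "u \<otimes> (t \<otimes> a) \<in> P" using u(2) by simp
  then show "a \<in> P"
    using primeideal.I_prime[OF prime_P] u(1) bt(3) assms(1) T_closed(2) T_notin
    by (meson m_closed)
next
  assume "a \<in> P"
  then show "frac R T a s \<in> loc_ideal R P" using assms(2) unfolding loc_ideal_eq by auto
qed

text \<open>The class of a/s, with numerator and denominator kept visible so that computations in
  the residue field become statements about \<open>P\<close>.\<close>

definition residue :: "'a \<Rightarrow> 'a \<Rightarrow> ('a \<times> 'a) set set" where
  "residue a s = loc_ideal R P +>\<^bsub>L\<^esub> frac R T a s"

text \<open>In contrast to equality of fractions no multiplier u appears, because \<open>P\<close>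
  is prime.\<close>

lemma residue_eq_iff:
  assumes "a \<in> carrier R" "s \<in> T" "b \<in> carrier R" "t \<in> T"
  shows "residue a s = residue b t \<longleftrightarrow> (t \<otimes> a) \<ominus> (s \<otimes> b) \<in> P"
proof -
  interpret L: cring L by (rule cring_loc)
  have "residue a s = residue b t \<longleftrightarrow> frac R T a s \<ominus>\<^bsub>L\<^esub> frac R T b t \<in> loc_ideal R P"
    unfolding residue_def
    using L.quotient_eq_iff_same_a_r_cos[OF ideal_loc_ideal] frac_closed assms by auto
  also have "\<dots> \<longleftrightarrow> (t \<otimes> a) \<ominus> (s \<otimes> b) \<in> P"
    using assms T_closed(2,3) by (simp add: loc_minus frac_in_loc_ideal_iff)
  finally show ?thesis .
qed

lemma residue_field_carrier:
  "carrier (residue_field R P) = {residue a s | a s. a \<in> carrier R \<and> s \<in> T}"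
proof -
  have "carrier (residue_field R P) = (\<Union>x\<in>carrier L. {loc_ideal R P +>\<^bsub>L\<^esub> x})"
    unfolding residue_field_def T_def[symmetric] FactRing_def A_RCOSETS_def' by simp
  then show ?thesis unfolding loc_carrier residue_def by auto
qed

lemma residue_field_one: "\<one>\<^bsub>residue_field R P\<^esub> = residue \<one> \<one>"
  unfolding residue_field_def T_def[symmetric] residue_def
  by (simp add: FactRing_def loc_one)

lemma residue_field_mult:
  assumes "a \<in> carrier R" "s \<in> T" "b \<in> carrier R" "t \<in> T"
  shows "residue a s \<otimes>\<^bsub>residue_field R P\<^esub> residue b t = residue (a \<otimes> b) (s \<otimes> t)"
  unfolding residue_field_def T_def[symmetric] residue_def
  using ideal.rcoset_mult_add[OF ideal_loc_ideal frac_closed[OF assms(1,2)] frac_closed[OF assms(3,4)]]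
  by (simp add: FactRing_def loc_mult[OF assms])

lemma residue_field_add:
  assumes "a \<in> carrier R" "s \<in> T" "b \<in> carrier R" "t \<in> T"
  shows "residue a s \<oplus>\<^bsub>residue_field R P\<^esub> residue b t = residue ((t \<otimes> a) \<oplus> (s \<otimes> b)) (s \<otimes> t)"
  unfolding residue_field_def T_def[symmetric] residue_def
  using ideal.a_rcos_sum[OF ideal_loc_ideal frac_closed[OF assms(1,2)] frac_closed[OF assms(3,4)]]
  by (simp add: FactRing_def loc_add[OF assms])

lemma residue_memD:
  assumes "y \<in> residue a s" and "a \<in> carrier R" "s \<in> T"
  obtains b t where "b \<in> carrier R" "t \<in> T" "y = frac R T b t" "residue b t = residue a s"
proof -
  interpret L: cring L by (rule cring_loc)
  interpret I: ideal "loc_ideal R P" L by (rule ideal_loc_ideal)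
  have "y \<in> carrier L"
    using assms(1) frac_closed[OF assms(2,3)] I.a_Hcarr
    unfolding residue_def a_r_coset_def' by auto
  then obtain b t where bt: "b \<in> carrier R" "t \<in> T" "y = frac R T b t" by (rule loc_carrierE)
  have "residue b t = residue a s"
    using I.a_repr_independence'[OF _ frac_closed[OF assms(2,3)], of y] assms(1)
    unfolding residue_def bt(3)[symmetric] by simp
  then show thesis using bt that by simp
qed

lemma residue_self: "a \<in> carrier R \<Longrightarrow> s \<in> T \<Longrightarrow> frac R T a s \<in> residue a s"
proof -
  assume "a \<in> carrier R" "s \<in> T"
  interpret I: ideal "loc_ideal R P" L by (rule ideal_loc_ideal)
  show ?thesis unfolding residue_def
    using I.a_rcos_self[OF frac_closed[OF \<open>a \<in> carrier R\<close> \<open>s \<in> T\<close>]] .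
qed

end

section \<open>The residual map\<close>

context cring
begin

lemma primeideal_contract:
  assumes "subring K R" and "primeideal Q R"
  shows "primeideal (Q \<inter> K) (R\<lparr>carrier := K\<rparr>)"
proof -
  note Ks = subringE[OF assms(1)]
  interpret K: cring "R\<lparr>carrier := K\<rparr>"
    using subcring_iff[OF Ks(1)] subcringI'[OF assms(1)] by simp
  have "ideal Q R" using assms(2) by (simp add: primeideal_def)
  note I = ideal_closed[OF this]
  show ?thesis
  proof (rule primeidealI)
    show "ideal (Q \<inter> K) (R\<lparr>carrier := K\<rparr>)"
    proof (rule K.cring_idealI)
      fix a r assume "a \<in> Q \<inter> K" "r \<in> carrier (R\<lparr>carrier := K\<rparr>)"
      then show "r \<otimes>\<^bsub>R\<lparr>carrier := K\<rparr>\<^esub> a \<in> Q \<inter> K" using I(6)[of a r] Ks(1,6) by auto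
    qed (use I(2,3) Ks(2,7) in auto)
    show "cring (R\<lparr>carrier := K\<rparr>)" by (rule K.cring_axioms)
    show "carrier (R\<lparr>carrier := K\<rparr>) \<noteq> Q \<inter> K" using one_notin_proper(1)[OF assms(2)] Ks(3) by auto
    fix a b assume "a \<in> carrier (R\<lparr>carrier := K\<rparr>)" "b \<in> carrier (R\<lparr>carrier := K\<rparr>)"
      "a \<otimes>\<^bsub>R\<lparr>carrier := K\<rparr>\<^esub> b \<in> Q \<inter> K"
    then show "a \<in> Q \<inter> K \<or> b \<in> Q \<inter> K" using primeideal.I_prime[OF assms(2), of a b] Ks(1) by auto
  qed
qed

text \<open>The map is a homomorphism and always injective, so only surjectivity matters. It
  suffices to reach the fractions b/1: denominators are elements of the big ring too, and their
  residues can be inverted.\<close>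

lemma residual_map_iso_iff:
  assumes K: "subring K R" and Q: "primeideal Q R"
  shows "residual_map R Q \<in> ring_iso (residue_field (R\<lparr>carrier := K\<rparr>) (Q \<inter> K)) (residue_field R Q)
    \<longleftrightarrow> (\<forall>b\<in>carrier R. \<exists>a\<in>K. \<exists>t\<in>K - Q. t \<otimes> b \<ominus> a \<in> Q)"
proof -
  note Ks = subringE[OF K]
  define A where "A = R\<lparr>carrier := K\<rparr>"
  have A: "carrier A = K" "(\<otimes>\<^bsub>A\<^esub>) = (\<otimes>)" "\<one>\<^bsub>A\<^esub> = \<one>" "(\<oplus>\<^bsub>A\<^esub>) = (\<oplus>)"
    by (simp_all add: A_def)
  have "cring A"
    unfolding A_def using subcring_iff[OF Ks(1)] subcringI'[OF K] by simp
  then interpret S: prime_localization R Q "carrier R - Q"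
    + A: prime_localization A "Q \<inter> K" "carrier A - Q \<inter> K"
    using Q primeideal_contract[OF K Q]
    by (auto intro!: prime_localization.intro prime_localization_axioms.intro cring_axioms
        simp: A_def)
  have TA: "K - Q \<inter> K = K - Q" by auto
  have sub: "s \<in> carrier R - Q" if "s \<in> K - Q" for s using that Ks(1) by auto
  have idQ: "ideal Q R" using Q by (simp add: primeideal_def)
  have frac_eq: "frac R (carrier R - Q) a s = frac R (carrier R - Q) b t"
    if eq: "frac A (K - Q) a s = frac A (K - Q) b t" and m: "a \<in> K" "s \<in> K - Q" "b \<in> K" "t \<in> K - Q" for a s b t
  proof -
    obtain u where "u \<in> K - Q" "u \<otimes> (t \<otimes> a) = u \<otimes> (s \<otimes> b)"
      using eq A.frac_eq_iff[unfolded A TA, OF m] by auto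
    then show ?thesis using S.frac_eq_iff[of a s b t] m sub Ks(1) by blast
  qed
  have loc_map: "loc_map R Q (frac A (K - Q) a s) = frac R (carrier R - Q) a s"
    if as: "a \<in> K" "s \<in> K - Q" for a s
    unfolding loc_map_def
  proof (rule UN_pair_const)
    show "(a, s) \<in> frac A (K - Q) a s" using A.frac_self[unfolded A TA] as by blast
    fix b t assume "(b, t) \<in> frac A (K - Q) a s"
    note A.frac_memD[unfolded A TA, OF this]
    then show "frac R (carrier R - Q) b t = frac R (carrier R - Q) a s"
      using frac_eq as by blast
  qed
  \<comment> \<open>The same membership in \<open>Q\<close> decides equality on the side of the big
    ring, which gives well-definedness of the map and its injectivity together.\<close>
  have residue_A: "A.residue a s = A.residue b t \<longleftrightarrow> t \<otimes> a \<ominus> s \<otimes> b \<in> Q"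
    if "a \<in> K" "s \<in> K - Q" "b \<in> K" "t \<in> K - Q" for a s b t
  proof -
    have "t \<otimes> a \<in> K" "s \<otimes> b \<in> K" using that Ks(6) by auto
    moreover then have "t \<otimes> a \<ominus> s \<otimes> b \<in> K" using Ks(5,7) by (simp add: a_minus_def)
    ultimately show ?thesis
      using A.residue_eq_iff[unfolded A TA, OF that] subring_a_minus[OF K, of "t \<otimes> a" "s \<otimes> b"]
      by (simp add: A_def)
  qed
  have map: "residual_map R Q (A.residue a s) = S.residue a s" if as: "a \<in> K" "s \<in> K - Q" for a s
  proof -
    have "loc_ideal R Q +>\<^bsub>loc_at R Q\<^esub> loc_map R Q y = S.residue a s" if y: "y \<in> A.residue a s" for y
    proof -
      obtain b t where bt: "b \<in> K" "t \<in> K - Q" "y = frac A (K - Q) b t" "A.residue b t = A.residue a s"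
        by (rule A.residue_memD[unfolded A TA, OF y as])
      then have "S.residue b t = S.residue a s"
        using residue_A[OF bt(1,2) as] S.residue_eq_iff[of b t a s] as sub Ks(1) by auto
      then show ?thesis unfolding bt(3) loc_map[OF bt(1,2)] S.residue_def .
    qed
    moreover have "A.residue a s \<noteq> {}" using A.residue_self[unfolded A TA, OF as] by auto
    ultimately show ?thesis unfolding residual_map_def by auto
  qed
  have carrier_A: "carrier (residue_field A (Q \<inter> K)) = {A.residue a s | a s. a \<in> K \<and> s \<in> K - Q}"
    by (rule A.residue_field_carrier[unfolded A TA])
  have eq_S: "S.residue a s = S.residue b t \<longleftrightarrow> t \<otimes> a \<ominus> s \<otimes> b \<in> Q"
    if "a \<in> carrier R" "s \<in> carrier R - Q" "b \<in> carrier R" "t \<in> carrier R - Q" for a s b t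
    using S.residue_eq_iff that by simp
  show ?thesis unfolding A_def[symmetric]
  proof
    assume "residual_map R Q \<in> ring_iso (residue_field A (Q \<inter> K)) (residue_field R Q)"
    then have img: "residual_map R Q ` carrier (residue_field A (Q \<inter> K)) = carrier (residue_field R Q)"
      using ring_iso_memE(5) bij_betw_imp_surj_on by blast
    show "\<forall>b\<in>carrier R. \<exists>a\<in>K. \<exists>t\<in>K - Q. t \<otimes> b \<ominus> a \<in> Q"
    proof
      fix b assume b: "b \<in> carrier R"
      have "S.residue b \<one> \<in> carrier (residue_field R Q)"
        using S.residue_field_carrier b S.T_closed(1) by auto
      then obtain a t where at: "a \<in> K" "t \<in> K - Q" "S.residue b \<one> = residual_map R Q (A.residue a t)"
        unfolding img[symmetric] carrier_A by auto
      then have "S.residue b \<one> = S.residue a t" using map by simp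
      then have "t \<otimes> b \<ominus> \<one> \<otimes> a \<in> Q" using eq_S[of b \<one> a t] b at sub Ks(1) S.T_closed(1) by auto
      moreover have "\<one> \<otimes> a = a" using at(1) Ks(1) by auto
      ultimately have "t \<otimes> b \<ominus> a \<in> Q" by simp
      then show "\<exists>a\<in>K. \<exists>t\<in>K - Q. t \<otimes> b \<ominus> a \<in> Q" using at(1,2) by blast
    qed
  next
    assume surj: "\<forall>b\<in>carrier R. \<exists>a\<in>K. \<exists>t\<in>K - Q. t \<otimes> b \<ominus> a \<in> Q"
    have in_S: "S.residue a s \<in> carrier (residue_field R Q)" if "a \<in> K" "s \<in> K - Q" for a s
      using that S.residue_field_carrier sub Ks(1) by blast
    have closed: "s \<otimes> t \<in> K - Q" "a \<otimes> b \<in> K" "t \<otimes> a \<oplus> s \<otimes> b \<in> K"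
      if "a \<in> K" "s \<in> K - Q" "b \<in> K" "t \<in> K - Q" for a s b t
      using that Ks(6,7) A.T_closed(3)[unfolded A TA, OF that(2,4)] by auto
    show "residual_map R Q \<in> ring_iso (residue_field A (Q \<inter> K)) (residue_field R Q)"
    proof (rule ring_iso_memI)
      fix x assume "x \<in> carrier (residue_field A (Q \<inter> K))"
      then obtain a s where x: "x = A.residue a s" "a \<in> K" "s \<in> K - Q" unfolding carrier_A by auto
      then show "residual_map R Q x \<in> carrier (residue_field R Q)" using map in_S by simp
      fix y assume "y \<in> carrier (residue_field A (Q \<inter> K))"
      then obtain b t where y: "y = A.residue b t" "b \<in> K" "t \<in> K - Q" unfolding carrier_A by auto
      have bt: "b \<in> carrier R" "t \<in> carrier R - Q" "a \<in> carrier R" "s \<in> carrier R - Q"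
        using x y sub Ks(1) by auto
      have "x \<otimes>\<^bsub>residue_field A (Q \<inter> K)\<^esub> y = A.residue (a \<otimes> b) (s \<otimes> t)"
        using A.residue_field_mult[unfolded A TA, OF x(2,3) y(2,3)] x(1) y(1) by simp
      then show "residual_map R Q (x \<otimes>\<^bsub>residue_field A (Q \<inter> K)\<^esub> y) =
          residual_map R Q x \<otimes>\<^bsub>residue_field R Q\<^esub> residual_map R Q y"
        using S.residue_field_mult[OF bt(3,4,1,2)] map closed x y by simp
      have "x \<oplus>\<^bsub>residue_field A (Q \<inter> K)\<^esub> y = A.residue (t \<otimes> a \<oplus> s \<otimes> b) (s \<otimes> t)"
        using A.residue_field_add[unfolded A TA, OF x(2,3) y(2,3)] x(1) y(1) by simp
      then show "residual_map R Q (x \<oplus>\<^bsub>residue_field A (Q \<inter> K)\<^esub> y) =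
          residual_map R Q x \<oplus>\<^bsub>residue_field R Q\<^esub> residual_map R Q y"
        using S.residue_field_add[OF bt(3,4,1,2)] map closed x y by simp
    next
      show "residual_map R Q \<one>\<^bsub>residue_field A (Q \<inter> K)\<^esub> = \<one>\<^bsub>residue_field R Q\<^esub>"
        using A.residue_field_one S.residue_field_one map[of \<one> \<one>] Ks(3) S.T_closed(1)
        unfolding A by simp
    next
      have "inj_on (residual_map R Q) (carrier (residue_field A (Q \<inter> K)))"
      proof (rule inj_onI)
        fix x y assume "x \<in> carrier (residue_field A (Q \<inter> K))" "y \<in> carrier (residue_field A (Q \<inter> K))"
          and eq: "residual_map R Q x = residual_map R Q y"
        then obtain a s b t where x: "x = A.residue a s" "a \<in> K" "s \<in> K - Q"
          and y: "y = A.residue b t" "b \<in> K" "t \<in> K - Q" unfolding carrier_A by auto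
        have bt: "b \<in> carrier R" "t \<in> carrier R - Q" "a \<in> carrier R" "s \<in> carrier R - Q"
          using x y sub Ks(1) by auto
        show "x = y" using eq residue_A[OF x(2,3) y(2,3)] eq_S[OF bt(3,4,1,2)] map x y by simp
      qed
      moreover have "carrier (residue_field R Q) \<subseteq> residual_map R Q ` carrier (residue_field A (Q \<inter> K))"
      proof
        fix z assume "z \<in> carrier (residue_field R Q)"
        then obtain b s where z: "z = S.residue b s" "b \<in> carrier R" "s \<in> carrier R - Q"
          using S.residue_field_carrier by auto
        \<comment> \<open>With b congruent to a/t and s congruent to c/v, the fraction b/s is
          congruent to (v a)/(t c). The new denominator is admissible because c, congruent to v s,
          is outside \<open>Q\<close>.\<close>
        obtain a t where at: "a \<in> K" "t \<in> K - Q" "t \<otimes> b \<ominus> a \<in> Q" using surj z(2) by blast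
        obtain c v where cv: "c \<in> K" "v \<in> K - Q" "v \<otimes> s \<ominus> c \<in> Q" using surj z(3) by blast
        have carr: "a \<in> carrier R" "t \<in> carrier R" "c \<in> carrier R" "v \<in> carrier R"
          "b \<in> carrier R" "s \<in> carrier R" using at cv z Ks(1) by auto
        note I = ideal_closed[OF idQ]
        have "c \<notin> Q"
        proof
          assume "c \<in> Q"
          then have "(v \<otimes> s \<ominus> c) \<oplus> c \<in> Q" by (rule I(3)[OF cv(3)])
          moreover have "(v \<otimes> s \<ominus> c) \<oplus> c = v \<otimes> s" using carr by (simp add: ring_normal)
          ultimately show False using primeideal.I_prime[OF Q carr(4,6)] cv(2) z(3) by auto
        qed
        then have tc: "t \<otimes> c \<in> K - Q" using closed(1)[of \<one> t \<one> c] Ks(3) at(2) cv(1) by auto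
        have va: "v \<otimes> a \<in> K" using Ks(6) cv at by auto
        have "(t \<otimes> c) \<otimes> b \<ominus> s \<otimes> (v \<otimes> a) =
            c \<otimes> (t \<otimes> b \<ominus> a) \<ominus> a \<otimes> (v \<otimes> s \<ominus> c)"
          using carr by (simp add: ring_normal)
        also have "\<dots> \<in> Q" by (rule I(5)[OF I(6)[OF at(3) carr(3)] I(6)[OF cv(3) carr(1)]])
        finally have "z = S.residue (v \<otimes> a) (t \<otimes> c)"
          unfolding z(1) using eq_S[of b s "v \<otimes> a" "t \<otimes> c"] z carr sub[OF tc] by simp
        then have "z = residual_map R Q (A.residue (v \<otimes> a) (t \<otimes> c))" using map[OF va tc] by simp
        moreover have "A.residue (v \<otimes> a) (t \<otimes> c) \<in> carrier (residue_field A (Q \<inter> K))"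
          unfolding carrier_A using va tc by auto
        ultimately show "z \<in> residual_map R Q ` carrier (residue_field A (Q \<inter> K))" by simp
      qed
      moreover have "residual_map R Q ` carrier (residue_field A (Q \<inter> K)) \<subseteq> carrier (residue_field R Q)"
        unfolding carrier_A using map in_S by auto
      ultimately show "bij_betw (residual_map R Q) (carrier (residue_field A (Q \<inter> K)))
          (carrier (residue_field R Q))" unfolding bij_betw_def by blast
    qed
  qed
qed

end

section \<open>Support and the field of two elements\<close>

lemma carrier_ZFact_2: "carrier (ZFact 2) = {ZMod 2 0, ZMod 2 1}"
proof -
  have "carrier (ZFact 2) = range (ZMod 2)"
    by (auto simp: ZFact_defs ZMod_def A_RCOSETS_def' )
  moreover have "ZMod 2 n \<in> {ZMod 2 0, ZMod 2 1}" for n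
    using ZMod_mod[of 2 n] mod_2_eq_odd[of n] by (cases "even n") auto
  ultimately show ?thesis by auto
qed

context cring
begin

text \<open>From left to right by counting: the cosets of 0, 1 and a third residue would be three
  elements of a set with at most two. From right to left the isomorphism is induced by the parity
  map from the integers.\<close>

lemma Quot_iso_ZFact_2_iff:
  assumes M: "maximalideal M R"
  shows "R Quot M \<simeq> ZFact 2 \<longleftrightarrow> (\<forall>a\<in>carrier R. a \<in> M \<or> \<one> \<ominus> a \<in> M)"
proof -
  have id: "ideal M R" using M by (simp add: maximalideal_def)
  interpret ideal M R by (rule id)
  have one: "\<one> \<notin> M" by (rule one_notin_proper(2)[OF M])
  note I = ideal_closed[OF id]
  have eq: "M +> a = M +> b \<longleftrightarrow> a \<ominus> b \<in> M" if "a \<in> carrier R" "b \<in> carrier R" for a b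
    using quotient_eq_iff_same_a_r_cos[OF id that] by simp
  have carrier_Q: "carrier (R Quot M) = (\<Union>a\<in>carrier R. {M +> a})"
    unfolding FactRing_def A_RCOSETS_def' by simp
  have minus_zero: "a \<ominus> \<zero> = a" if "a \<in> carrier R" for a using that by (simp add: a_minus_def)
  show ?thesis
  proof
    assume iso: "R Quot M \<simeq> ZFact 2"
    then have card: "card (carrier (R Quot M)) = card (carrier (ZFact 2))" by (rule ring_iso_same_card)
    obtain f where "f \<in> ring_iso (R Quot M) (ZFact 2)" using iso unfolding is_ring_iso_def by auto
    then have "bij_betw f (carrier (R Quot M)) (carrier (ZFact 2))" by (rule ring_iso_memE(5))
    then have fin: "finite (carrier (R Quot M))"
      using bij_betw_finite carrier_ZFact_2 by fastforce
    have card2: "card (carrier (R Quot M)) \<le> 2"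
      unfolding card carrier_ZFact_2 by (simp add: card_insert_if)
    show "\<forall>a\<in>carrier R. a \<in> M \<or> \<one> \<ominus> a \<in> M"
    proof (rule ballI, rule ccontr)
      fix a assume a: "a \<in> carrier R" and neg: "\<not> (a \<in> M \<or> \<one> \<ominus> a \<in> M)"
      have "M +> \<one> \<noteq> M +> \<zero>" "M +> a \<noteq> M +> \<zero>" "M +> \<one> \<noteq> M +> a"
        using neg one a eq minus_zero by auto
      then have "card {M +> \<zero>, M +> \<one>, M +> a} = 3" by (auto simp: card_insert_if)
      moreover have "{M +> \<zero>, M +> \<one>, M +> a} \<subseteq> carrier (R Quot M)"
        unfolding carrier_Q using a by auto
      ultimately show False using card_mono[OF fin, of "{M +> \<zero>, M +> \<one>, M +> a}"] card2 by linarith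
    qed
  next
    assume two: "\<forall>a\<in>carrier R. a \<in> M \<or> \<one> \<ominus> a \<in> M"
    interpret Q: cring "R Quot M" by (rule quotient_is_cring[OF cring_axioms])
    define h :: "int \<Rightarrow> 'a set" where "h n = (if even n then M +> \<zero> else M +> \<one>)" for n
    \<comment> \<open>Applying \<open>two\<close> to 1 + 1, where 1 - (1 + 1) = -1 is outside
      \<open>M\<close>, yields 1 + 1 in \<open>M\<close>. This makes h additive on two odd
      integers.\<close>
    have "\<ominus> \<one> \<notin> M" using I(4)[of "\<ominus> \<one>"] one by auto
    moreover have "\<one> \<ominus> (\<one> \<oplus> \<one>) = \<ominus> \<one>" by (simp add: a_minus_def minus_add r_neg2)
    ultimately have "\<one> \<oplus> \<one> \<in> M" using two[rule_format, of "\<one> \<oplus> \<one>"] by simp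
    then have oo: "M +> (\<one> \<oplus> \<one>) = M +> \<zero>" using eq minus_zero by simp
    have add: "(M +> a) \<oplus>\<^bsub>R Quot M\<^esub> (M +> b) = M +> (a \<oplus> b)"
      if "a \<in> carrier R" "b \<in> carrier R" for a b
      using a_rcos_sum[OF that] by (simp add: FactRing_def)
    have mult: "(M +> a) \<otimes>\<^bsub>R Quot M\<^esub> (M +> b) = M +> (a \<otimes> b)"
      if "a \<in> carrier R" "b \<in> carrier R" for a b
      using rcoset_mult_add[OF that] by (simp add: FactRing_def)
    have "ring_hom_ring \<Z> (R Quot M) h"
    proof (rule ring_hom_ringI)
      show "ring \<Z>" "ring (R Quot M)" by (rule int.ring_axioms, rule Q.ring_axioms)
      fix x y :: int
      show "h x \<in> carrier (R Quot M)" unfolding carrier_Q h_def by auto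
      show "h (x \<otimes>\<^bsub>\<Z>\<^esub> y) = h x \<otimes>\<^bsub>R Quot M\<^esub> h y" by (simp add: h_def mult)
      show "h (x \<oplus>\<^bsub>\<Z>\<^esub> y) = h x \<oplus>\<^bsub>R Quot M\<^esub> h y" by (simp add: h_def add oo)
    qed (simp add: h_def FactRing_def)
    then interpret h: ring_hom_ring "\<Z>" "R Quot M" h .
    have zero: "\<zero>\<^bsub>R Quot M\<^esub> = M +> \<zero>" using a_rcos_zero[OF id I(2)] by (simp add: FactRing_def)
    have "M +> \<one> \<noteq> M +> \<zero>" using one eq minus_zero by auto
    then have "a_kernel \<Z> (R Quot M) h = Idl\<^bsub>\<Z>\<^esub> {2}"
      unfolding a_kernel_def' int_Idl zero by (auto simp: h_def elim!: evenE)
    moreover have "h ` carrier \<Z> = carrier (R Quot M)"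
    proof -
      have "M +> a \<in> range h" if a: "a \<in> carrier R" for a
      proof -
        have "a \<ominus> \<zero> \<in> M \<or> \<one> \<ominus> a \<in> M" using two a minus_zero by simp
        then have "M +> a = h 0 \<or> M +> a = h 1" using eq[of a \<zero>] eq[of \<one> a] a by (auto simp: h_def)
        then show ?thesis by (metis rangeI)
      qed
      moreover have "h n \<in> carrier (R Quot M)" for n unfolding carrier_Q h_def by auto
      ultimately show ?thesis unfolding carrier_Q by auto
    qed
    ultimately have "ZFact 2 \<simeq> R Quot M"
      using h.FactRing_iso unfolding ZFact_def by simp
    then show "R Quot M \<simeq> ZFact 2"
      using ring_iso_sym ZFact_is_cring by (metis cring.axioms(1))
  qed
qed

text \<open>A polynomial is a list whose head, the leading coefficient, is nonzero. A monic one is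
  therefore \<open>\<one> # l\<close>, and such a list is a polynomial because 1 differs from
  0.\<close>

lemma integral_extension_iff:
  assumes "subring K R" and "\<one> \<noteq> \<zero>"
  shows "integral_extension K R \<longleftrightarrow>
    (\<forall>x\<in>carrier R. \<exists>l. set l \<subseteq> K \<and> eval (\<one> # l) x = \<zero>)"
proof -
  have "(\<exists>p\<in>carrier (univ_poly R K). p \<noteq> [] \<and> lead_coeff p = \<one> \<and> eval p x = \<zero>) \<longleftrightarrow>
      (\<exists>l. set l \<subseteq> K \<and> eval (\<one> # l) x = \<zero>)" for x
  proof
    assume "\<exists>p\<in>carrier (univ_poly R K). p \<noteq> [] \<and> lead_coeff p = \<one> \<and> eval p x = \<zero>"
    then obtain p where p: "polynomial\<^bsub>R\<^esub> K p" "p \<noteq> []" "lead_coeff p = \<one>" "eval p x = \<zero>"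
      by (auto simp: univ_poly_def)
    then obtain l where "p = \<one> # l" by (cases p) auto
    then show "\<exists>l. set l \<subseteq> K \<and> eval (\<one> # l) x = \<zero>"
      using p by (auto simp: polynomial_def)
  next
    assume "\<exists>l. set l \<subseteq> K \<and> eval (\<one> # l) x = \<zero>"
    then obtain l where "set l \<subseteq> K" "eval (\<one> # l) x = \<zero>" by auto
    then show "\<exists>p\<in>carrier (univ_poly R K). p \<noteq> [] \<and> lead_coeff p = \<one> \<and> eval p x = \<zero>"
      using assms(2) subringE(3)[OF assms(1)]
      by (intro bexI[of _ "\<one> # l"]) (auto simp: univ_poly_def polynomial_def)
  qed
  then show ?thesis unfolding integral_extension_def by simp
qed

section \<open>The support of the quotient module\<close>

lemma quot_module_smult:
  assumes K: "subring K R" and r: "r \<in> K" and x: "x \<in> carrier R"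
  shows "r \<odot>\<^bsub>quot_module K R\<^esub> (K +> x) = K +> (r \<otimes> x)"
proof -
  note Ks = subringE[OF K]
  have rc: "r \<in> carrier R" using r Ks(1) by auto
  interpret abelian_subgroup K R
    using abelian_subgroupI3[OF additive_subgroupI[OF subring.axioms(1)[OF K]] abelian_group_axioms] .
  have "K +> (r \<otimes> y) = K +> (r \<otimes> x)" if y: "y \<in> K +> x" for y
  proof -
    obtain k where k: "k \<in> K" "y = k \<oplus> x" using y unfolding a_r_coset_def' by auto
    have kc: "k \<in> carrier R" using k Ks(1) by auto
    have "r \<otimes> y = r \<otimes> k \<oplus> r \<otimes> x" unfolding k using rc kc x by (simp add: r_distr)
    then have "r \<otimes> y \<in> K +> (r \<otimes> x)" using Ks(6)[OF r k(1)] unfolding a_r_coset_def' by auto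
    then show ?thesis using a_repr_independence'[of "r \<otimes> y" "r \<otimes> x"] rc x by simp
  qed
  then have "(\<Union>y\<in>K +> x. K +> (r \<otimes> y)) = (\<Union>y\<in>K +> x. K +> (r \<otimes> x))"
    by (intro SUP_cong) auto
  also have "\<dots> = K +> (r \<otimes> x)" using a_rcos_self[OF x] by auto
  finally show ?thesis by (simp add: quot_module_def)
qed

lemma coset_eq_sub_iff:
  assumes "subring K R" and "x \<in> carrier R"
  shows "K +> x = K \<longleftrightarrow> x \<in> K"
proof -
  interpret abelian_subgroup K R
    using abelian_subgroupI3[OF additive_subgroupI[OF subring.axioms(1)[OF assms(1)]] abelian_group_axioms] .
  show ?thesis using a_rcos_self[OF assms(2)] a_coset_join2[OF assms(2) a_subgroup] by auto
qed

text \<open>The fraction s/1 is nonzero: equality with 0/1 would give a u outside \<open>M\<close>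
  with u s in \<open>K\<close>. Here one s serves for all t, whereas in \<open>MSuppD\<close> the
  element s may depend on t.\<close>

lemma MSuppI:
  assumes K: "subring K R" and M: "maximalideal M (R\<lparr>carrier := K\<rparr>)"
    and s: "s \<in> carrier R" "\<And>t. t \<in> K - M \<Longrightarrow> t \<otimes> s \<notin> K"
  shows "M \<in> MSupp K R"
proof -
  note Ks = subringE[OF K]
  note MK = subring_maximalideal[OF K M]
  let ?N = "quot_module K R" and ?T = "K - M"
  have one: "\<one> \<in> ?T" using Ks(3) MK(2) by simp
  have KN: "K \<in> carrier ?N"
    using coset_eq_sub_iff[OF K one_closed] Ks(3) unfolding quot_module_def A_RCOSETS_def' by auto
  have sN: "K +> s \<in> carrier ?N" using s(1) unfolding quot_module_def A_RCOSETS_def' by auto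
  have "mfrac ?T ?N (K +> s) \<one> \<noteq> mfrac ?T ?N K \<one>"
  proof
    assume eq: "mfrac ?T ?N (K +> s) \<one> = mfrac ?T ?N K \<one>"
    have "(K +> s, \<one>) \<in> mfrac ?T ?N (K +> s) \<one>"
      using sN one by (auto simp: mfrac_def mfrac_rel_def)
    then have "(K +> s, \<one>) \<in> mfrac ?T ?N K \<one>" using eq by simp
    then obtain u where u: "u \<in> ?T" "u \<odot>\<^bsub>?N\<^esub> (\<one> \<odot>\<^bsub>?N\<^esub> K) = u \<odot>\<^bsub>?N\<^esub> (\<one> \<odot>\<^bsub>?N\<^esub> (K +> s))"
      by (auto simp: mfrac_def mfrac_rel_def)
    have uc: "u \<in> K" "u \<in> carrier R" using u(1) Ks(1) by auto
    have zero: "r \<odot>\<^bsub>?N\<^esub> K = K" if "r \<in> K" for r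
    proof -
      have "r \<in> carrier R" using that Ks(1) by auto
      then show ?thesis using quot_module_smult[OF K that zero_closed]
        coset_eq_sub_iff[OF K zero_closed] Ks(2) by simp
    qed
    have "K = K +> (u \<otimes> s)"
      using u(2) zero uc quot_module_smult[OF K] Ks(3) s(1) by simp
    then show False using coset_eq_sub_iff[OF K, of "u \<otimes> s"] s uc u(1) by auto
  qed
  moreover have "mfrac ?T ?N (K +> s) \<one> \<in> carrier (loc_module (R\<lparr>carrier := K\<rparr>) ?T ?N)"
    using sN one unfolding loc_module_def mfrac_def quotient_def by auto
  moreover have "\<zero>\<^bsub>loc_module (R\<lparr>carrier := K\<rparr>) ?T ?N\<^esub> = mfrac ?T ?N K \<one>"
    by (simp add: loc_module_def quot_module_def)
  ultimately show ?thesis using M unfolding MSupp_def Let_def by auto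
qed

text \<open>If some t outside \<open>M\<close> multiplied the whole big ring into \<open>K\<close>,
  it would annihilate the quotient module, and the localization would vanish.\<close>

lemma MSuppD:
  assumes K: "subring K R" and "M \<in> MSupp K R"
  shows "maximalideal M (R\<lparr>carrier := K\<rparr>)"
    and "\<And>t. t \<in> K - M \<Longrightarrow> \<exists>s\<in>carrier R. t \<otimes> s \<notin> K"
proof -
  note Ks = subringE[OF K]
  show M: "maximalideal M (R\<lparr>carrier := K\<rparr>)" using assms(2) by (simp add: MSupp_def)
  note MK = subring_maximalideal[OF K M]
  let ?N = "quot_module K R" and ?T = "K - M"
  show "\<exists>s\<in>carrier R. t \<otimes> s \<notin> K" if t: "t \<in> ?T" for t
  proof (rule ccontr)
    assume "\<not> ?thesis"
    then have kill: "t \<otimes> s \<in> K" if "s \<in> carrier R" for s using that by auto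
    have one: "\<one> \<in> ?T" using Ks(3) MK(2) by simp
    have carrN: "\<exists>y\<in>carrier R. x = K +> y" if "x \<in> carrier ?N" for x
      using that unfolding quot_module_def A_RCOSETS_def' by auto
    have tzero: "t \<odot>\<^bsub>?N\<^esub> (s \<odot>\<^bsub>?N\<^esub> x) = K" if x: "x \<in> carrier ?N" and s: "s \<in> K" for x s
    proof -
      obtain y where y: "y \<in> carrier R" "x = K +> y" using carrN[OF x] by blast
      have c: "s \<in> carrier R" "t \<in> K" "t \<in> carrier R" using s t Ks(1) by auto
      show ?thesis
        unfolding y(2) using y(1) c s kill[of "s \<otimes> y"]
        by (simp add: quot_module_smult[OF K] coset_eq_sub_iff[OF K])
    qed
    \<comment> \<open>With t as multiplier any two fractions are equal, so every class is the full
      set of pairs.\<close>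
    have all: "mfrac ?T ?N x s = carrier ?N \<times> ?T" if "x \<in> carrier ?N" "s \<in> ?T" for x s
    proof -
      have "(y, w) \<in> mfrac ?T ?N x s" if "y \<in> carrier ?N" "w \<in> ?T" for y w
      proof -
        have "t \<odot>\<^bsub>?N\<^esub> (w \<odot>\<^bsub>?N\<^esub> x) = t \<odot>\<^bsub>?N\<^esub> (s \<odot>\<^bsub>?N\<^esub> y)"
          using tzero that \<open>x \<in> carrier ?N\<close> \<open>s \<in> ?T\<close> by simp
        then show ?thesis
          using that \<open>x \<in> carrier ?N\<close> \<open>s \<in> ?T\<close> t unfolding mfrac_def mfrac_rel_def by blast
      qed
      moreover have "mfrac ?T ?N x s \<subseteq> carrier ?N \<times> ?T" by (auto simp: mfrac_def mfrac_rel_def)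
      ultimately show ?thesis by auto
    qed
    have KN: "K \<in> carrier ?N"
      using coset_eq_sub_iff[OF K one_closed] Ks(3) unfolding quot_module_def A_RCOSETS_def' by auto
    have "\<zero>\<^bsub>loc_module (R\<lparr>carrier := K\<rparr>) ?T ?N\<^esub> = mfrac ?T ?N K \<one>"
      by (simp add: loc_module_def quot_module_def)
    then have zero: "\<zero>\<^bsub>loc_module (R\<lparr>carrier := K\<rparr>) ?T ?N\<^esub> = carrier ?N \<times> ?T"
      using all[OF KN one] by simp
    have "carrier (loc_module (R\<lparr>carrier := K\<rparr>) ?T ?N) = (\<Union>(x, s)\<in>carrier ?N \<times> ?T. {mfrac ?T ?N x s})"
      unfolding loc_module_def quotient_def mfrac_def by auto
    also have "\<dots> = {carrier ?N \<times> ?T}"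
      by (rule UN_pair_const[of K \<one>]) (use KN one all in auto)
    finally show False using assms(2) zero unfolding MSupp_def Let_def by simp
  qed
qed

end

section \<open>The equivalence in terms of localizations and supports\<close>

theorem theorem8p3:
  fixes S :: "('a, 'b) ring_scheme" and R :: "'a set"
  assumes "cring S" and "\<one>\<^bsub>S\<^esub> \<noteq> \<zero>\<^bsub>S\<^esub>"
    and "subcring R S"
    and "semilocal S"
  shows "strongly_local R S \<longleftrightarrow>
    seminormal R S \<and> infra_integral R S \<and> FIP R S \<and>
    (\<forall>M\<in>MSupp R S. S\<lparr>carrier := R\<rparr> Quot M \<simeq> ZFact 2)"
proof -
  interpret cring S by fact
  have K: "subring R S" using assms(3) by (rule subcring.axioms(1))
  note Ks = subringE[OF K]
  have Rc: "cring (S\<lparr>carrier := R\<rparr>)" using subcring_iff[OF Ks(1)] assms(3) by simp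
  have two_iff: "S\<lparr>carrier := R\<rparr> Quot M \<simeq> ZFact 2 \<longleftrightarrow> (\<forall>a\<in>R. a \<in> M \<or> \<one>\<^bsub>S\<^esub> \<ominus>\<^bsub>S\<^esub> a \<in> M)"
    if "maximalideal M (S\<lparr>carrier := R\<rparr>)" for M
    using cring.Quot_iso_ZFact_2_iff[OF Rc that] subring_a_minus[OF K] Ks(3) by simp
  have infra_iff: "infra_integral R S \<longleftrightarrow> integral_extension R S \<and>
      (\<forall>Q. primeideal Q S \<longrightarrow> (\<forall>b\<in>carrier S. \<exists>a\<in>R. \<exists>t\<in>R - Q. t \<otimes>\<^bsub>S\<^esub> b \<ominus>\<^bsub>S\<^esub> a \<in> Q))"
    unfolding infra_integral_def using residual_map_iso_iff[OF K] by auto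
  show ?thesis
  proof
    assume "strongly_local R S"
    then have U: "Units S \<subseteq> R" unfolding strongly_local_def Units_def by auto
    have fin: "finite {M. maximalideal M S}" using assms(4) by (simp add: semilocal_def)
    obtain e where "strongly_local_extension S R e"
      by (rule exists_strongly_local_extension[OF K U fin])
    then interpret strongly_local_extension S R e .
    have "seminormal R S"
      unfolding seminormal_def
    proof (intro ballI impI, elim conjE)
      fix b assume b: "b \<in> carrier S" "b [^]\<^bsub>S\<^esub> (2::nat) \<in> R"
      then have "b \<otimes>\<^bsub>S\<^esub> b \<in> R" by (simp add: numeral_2_eq_2)
      then show "b \<in> R" by (rule seminormal_square[OF b(1)])
    qed
    moreover have "integral_extension R S"
    proof (rule integral_extension_iff[OF K assms(2), THEN iffD2, rule_format])
      fix b assume b: "b \<in> carrier S"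
      then obtain r r' where r: "r \<in> R" "r' \<in> R"
        "b \<otimes>\<^bsub>S\<^esub> b \<oplus>\<^bsub>S\<^esub> (r \<otimes>\<^bsub>S\<^esub> b \<oplus>\<^bsub>S\<^esub> r') = \<zero>\<^bsub>S\<^esub>" using quadratic_over_K by blast
      moreover have "r \<in> carrier S" "r' \<in> carrier S" using r Ks(1) by auto
      \<comment> \<open>Coefficient lists start with the leading term, so this list stands for X^2 +
        r X + r'.\<close>
      ultimately have "eval [\<one>\<^bsub>S\<^esub>, r, r'] b = \<zero>\<^bsub>S\<^esub>" using b by (simp add: numeral_2_eq_2)
      then show "\<exists>l. set l \<subseteq> R \<and> eval (\<one>\<^bsub>S\<^esub> # l) b = \<zero>\<^bsub>S\<^esub>"
        using r by (intro exI[of _ "[r, r']"]) simp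
    qed
    then have "infra_integral R S" using infra_iff residually_surjective by blast
    moreover have "FIP R S" unfolding FIP_def by (rule finite_intermediate)
    moreover have "S\<lparr>carrier := R\<rparr> Quot M \<simeq> ZFact 2" if "M \<in> MSupp R S" for M
    proof -
      note D = MSuppD[OF K that]
      show ?thesis using two_iff[OF D(1)] residue_two[OF D] by blast
    qed
    ultimately show "seminormal R S \<and> infra_integral R S \<and> FIP R S \<and>
      (\<forall>M\<in>MSupp R S. S\<lparr>carrier := R\<rparr> Quot M \<simeq> ZFact 2)" by blast
  next
    assume *: "seminormal R S \<and> infra_integral R S \<and> FIP R S \<and>
      (\<forall>M\<in>MSupp R S. S\<lparr>carrier := R\<rparr> Quot M \<simeq> ZFact 2)"
    then have integral: "\<forall>x\<in>carrier S. \<exists>l. set l \<subseteq> R \<and> eval (\<one>\<^bsub>S\<^esub> # l) x = \<zero>\<^bsub>S\<^esub>"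
      using integral_extension_iff[OF K assms(2)] infra_iff by blast
    have residual: "\<exists>a\<in>R. \<exists>t\<in>R - Q. t \<otimes>\<^bsub>S\<^esub> b \<ominus>\<^bsub>S\<^esub> a \<in> Q"
      if "primeideal Q S" "b \<in> carrier S" for Q b
      using * infra_iff that by blast
    have two: "a \<in> P \<or> \<one>\<^bsub>S\<^esub> \<ominus>\<^bsub>S\<^esub> a \<in> P"
      if P: "maximalideal P (S\<lparr>carrier := R\<rparr>)" "s \<in> carrier S" "\<And>t. t \<in> R - P \<Longrightarrow> t \<otimes>\<^bsub>S\<^esub> s \<notin> R" "a \<in> R"
      for P s a
      using two_iff[OF P(1)] * MSuppI[OF K P(1,2,3)] P(4) by blast
    interpret infra_integral_extension S R
      by (intro infra_integral_extension.intro infra_integral_extension_axioms.intro cring_axioms K assms(2)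
          residual two) (use * integral in auto)
    note U = Units_sub_K
    show "strongly_local R S"
      unfolding strongly_local_def
    proof (rule equalityI; rule subsetI)
      fix u assume "u \<in> Units (S\<lparr>carrier := R\<rparr>)"
      then show "u \<in> Units S" using Ks(1) by (auto simp: Units_def)
    next
      \<comment> \<open>Membership of u alone would not make it a unit of the subring; its inverse
        is also a unit of \<open>S\<close> and hence lies in \<open>R\<close> too.\<close>
      fix u assume u: "u \<in> Units S"
      then have "u \<in> R" "inv\<^bsub>S\<^esub> u \<in> R" using U by auto
      then show "u \<in> Units (S\<lparr>carrier := R\<rparr>)"
        using Units_l_inv[OF u] Units_r_inv[OF u] by (auto simp: Units_def)
    qed
  qed
qed

end
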